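(* Let $\mathcal{U}$ (source) and $\mathcal{V}$ (target) be Markov kernels from a parameter space $\Theta$ to standard Borel spaces $\mathbb{X}$ and $\mathbb{Y}$ respectively; write $u(\cdot;\theta)=\mathcal{U}(\cdot|\theta)$ and $v(\cdot;\theta)=\mathcal{V}(\cdot|\theta)$, and let $X_\theta\sim u(\cdot;\theta)$. Suppose that: (1) there is a signed kernel $\mathcal{S}^*$ from $\mathbb{X}$ to $\mathbb{Y}$ that can be evaluated in time $T_{eval}$; let $\overline{\mathcal{S}}(\cdot|x)$ be the positive part of the signed measure $\mathcal{S}^*(\cdot|x)$; (2) there are $M>0$ and probability measures $\{\mathcal{P}(\cdot|x)\}_{x\in\mathbb{X}}$ on $\mathbb{Y}$ such that for every $x$ one can sample from $\mathcal{P}(\cdot|x)$ in time $T_{samp}$, and the Radon--Nikodym derivative satisfies $\frac{\mathrm{d}\overline{\mathcal{S}}}{\mathrm{d}\mathcal{P}}(y|x)\le M$ for all $x\in\mathbb{X}$, $y\in\mathbb{Y}$. Then for every $N\ge 1$ and every $y_0\in\mathbb{Y}$, the randomized algorithm $x\mapsto \textsc{rk}(x,N,M,y_0)$ runs in time $O(N(T_{eval}+T_{samp}))$ for every $x \in \mathbb{X}$, and $$\sup_{\theta\in\Theta}\big\|\mathcal{L}[\textsc{rk}(X_\theta,N,M,y_0)]-v(\cdot;\theta)\big\|_{\mathsf{TV}}\le 2\exp\Big\{-\frac{N}{M}\inf_{x\in\mathbb{X}}p(x)\Big\}+\varsigma(\mathcal{U},\mathcal{V};\mathcal{S}^* )+\|\mathcal{S}^*\circ\mathcal{U}-\widehat{\mathcal{T}}\circ\mathcal{U}\|_\infty$$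 $$\le 2\exp\Big\{-\frac{N}{M}\inf_{x\in\mathbb{X}}p(x)\Big\}+\varsigma(\mathcal{U},\mathcal{V};\mathcal{S}^* )+\frac12\sup_{\theta\in\Theta}\int_{\mathbb{X}}\big(|p(x)-1|+q(x)\big)\,u(\mathrm{d}x;\theta).$$
   Context: A signed kernel from $\mathbb{X}$ to $\mathbb{Y}$ is a map $\mathcal{S}(B|x)$ such that $\mathcal{S}(\cdot|x)$ is a finite signed measure on $\mathbb{Y}$ for each $x$ and $x\mapsto\mathcal{S}(B|x)$ is measurable for each Borel $B$; it is a Markov kernel if each $\mathcal{S}(\cdot|x)$ is a probability measure. Composition: $(\mathcal{S}\circ\mathcal{U})(C|\theta)=\int_{\mathbb{X}}\mathcal{S}(C|x)\,\mathcal{U}(\mathrm{d}x|\theta)$. For signed kernels, $\|\mathcal{S}-\mathcal{S}'\|_\infty=\sup_x\frac12\|\mathcal{S}(\cdot|x)-\mathcal{S}'(\cdot|x)\|_1$, where $\|\cdot\|_1$ is the total mass of the variation measure; for probability measures $\frac12\|\mu-\nu\|_1=\|\mu-\nu\|_{\mathsf{TV}}$. The signed deficiency is $\varsigma(\mathcal{U},\mathcal{V};\mathcal{S})=\|\mathcal{V}-\mathcal{S}\circ\mathcal{U}\|_\infty=\sup_{\theta\in\Theta}\frac12\|\mathcal{V}(\cdot|\theta)-(\mathcal{S}\circ\mathcal{U})(\cdot|\theta)\|_1$. $p(x)$ and $q(x)$ denote the total masses of the positive part and of the negative part of $\mathcal{S}^*(\cdot|x)$, respectively (so $p(x)=\overline{\mathcal{S}}(\mathbb{Y}|x)$);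 it is assumed that $p(x)>0$ for all $x$, and $\widehat{\mathcal{T}}$ is the Markov kernel $\widehat{\mathcal{T}}(C|x)=\overline{\mathcal{S}}(C|x)/p(x)$. Algorithm $\textsc{rk}(x,N,M,y_0)$: set $t=0$, $Y=y_0$ and mark $Y$ "unset". Repeat until $Y$ is set or $t\ge N+1$: draw $U_t\sim\mathsf{Unif}([0,1])$ and $Y_t\sim\mathcal{P}(\cdot|x)$, independent of each other and of the past; if $U_t\le\frac1M\frac{\mathrm{d}\overline{\mathcal{S}}}{\mathrm{d}\mathcal{P}}(Y_t|x)$, set $Y\leftarrow Y_t$ (now "set"); then $t\leftarrow t+1$. Output $Y$. When the input is a random variable $X_\theta$, the algorithm is run with $x=X_\theta$ and fresh independent randomness. $\mathcal{L}[\cdot]$ denotes the law. Running time is counted as $T_{samp}$ per sample from $\mathcal{P}(\cdot|x)$, $T_{eval}$ per evaluation of $\mathcal{S}^*$ (equivalently of the Radon--Nikodym derivative used in the acceptance test), and $O(1)$ for all other operations of an iteration. *)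

theory Defs
  imports "HOL-Probability.Probability" "HOL-Library.While_Combinator"
begin

definition standard_borel :: "'a measure \<Rightarrow> bool" where
  "standard_borel M \<longleftrightarrow>
     (\<exists>T. completely_metrizable_space T \<and> second_countable T \<and> topspace T = space M \<and>
          sets M = sigma_sets (topspace T) {G. openin T G})"


text \<open>Finite signed measures are real-valued set functions; only their values on \<^term>\<open>sets M\<close>
  matter.\<close>

definition signed_measure :: "'a measure \<Rightarrow> ('a set \<Rightarrow> real) \<Rightarrow> bool" where
  "signed_measure M \<mu> \<longleftrightarrow> \<mu> {} = 0 \<and>
     (\<forall>A::nat \<Rightarrow> 'a set. range A \<subseteq> sets M \<longrightarrow> disjoint_family A \<longrightarrow>
        (\<lambda>i. \<mu> (A i)) sums \<mu> (\<Union>i. A i))"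

definition is_jordan_decomposition ::
    "'a measure \<Rightarrow> ('a set \<Rightarrow> real) \<Rightarrow> 'a measure \<Rightarrow> 'a measure \<Rightarrow> bool" where
  "is_jordan_decomposition M \<mu> \<mu>p \<mu>n \<longleftrightarrow>
     finite_measure \<mu>p \<and> finite_measure \<mu>n \<and> sets \<mu>p = sets M \<and> sets \<mu>n = sets M \<and>
     (\<exists>H\<in>sets M. emeasure \<mu>n H = 0 \<and> emeasure \<mu>p (space M - H) = 0) \<and>
     (\<forall>A\<in>sets M. \<mu> A = measure \<mu>p A - measure \<mu>n A)"

text \<open>For a finite signed measure, the pair below exists and is unique by the Hahn-Jordan
  theorem.\<close>

definition jordan_decomposition ::
    "'a measure \<Rightarrow> ('a set \<Rightarrow> real) \<Rightarrow> 'a measure \<times> 'a measure" where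
  "jordan_decomposition M \<mu> = (THE d. is_jordan_decomposition M \<mu> (fst d) (snd d))"

definition pos_part :: "'a measure \<Rightarrow> ('a set \<Rightarrow> real) \<Rightarrow> 'a measure" where
  "pos_part M \<mu> = fst (jordan_decomposition M \<mu>)"

definition neg_part :: "'a measure \<Rightarrow> ('a set \<Rightarrow> real) \<Rightarrow> 'a measure" where
  "neg_part M \<mu> = snd (jordan_decomposition M \<mu>)"

definition pos_mass :: "'a measure \<Rightarrow> ('a set \<Rightarrow> real) \<Rightarrow> real" where
  "pos_mass M \<mu> = measure (pos_part M \<mu>) (space M)"

definition neg_mass :: "'a measure \<Rightarrow> ('a set \<Rightarrow> real) \<Rightarrow> real" where
  "neg_mass M \<mu> = measure (neg_part M \<mu>) (space M)"

definition variation :: "'a measure \<Rightarrow> ('a set \<Rightarrow> real) \<Rightarrow> 'a set \<Rightarrow> ennreal" where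
  "variation M \<mu> A =
     (SUP \<A> \<in> {\<A>. finite \<A> \<and> \<A> \<subseteq> sets M \<and> disjoint \<A> \<and> \<Union>\<A> = A}.
        ennreal (\<Sum>B\<in>\<A>. \<bar>\<mu> B\<bar>))"

definition tv_dist :: "'a measure \<Rightarrow> 'a measure \<Rightarrow> 'a measure \<Rightarrow> ennreal" where
  "tv_dist M \<mu> \<nu> = variation M (\<lambda>B. measure \<mu> B - measure \<nu> B) (space M) / 2"


text \<open>The value of a signed kernel \<open>S\<close> at the set \<open>B\<close>, given \<open>x\<close>, is \<open>S x B\<close>. Markov kernels are
  measurable maps into \<^const>\<open>prob_algebra\<close>; \<open>set_kernel\<close> views them as signed kernels.\<close>

definition signed_kernel :: "'a measure \<Rightarrow> 'b measure \<Rightarrow> ('a \<Rightarrow> 'b set \<Rightarrow> real) \<Rightarrow> bool" where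
  "signed_kernel X Y S \<longleftrightarrow>
     (\<forall>x\<in>space X. signed_measure Y (S x)) \<and> (\<forall>B\<in>sets Y. (\<lambda>x. S x B) \<in> borel_measurable X)"

definition set_kernel :: "('a \<Rightarrow> 'b measure) \<Rightarrow> 'a \<Rightarrow> 'b set \<Rightarrow> real" where
  "set_kernel K x B = measure (K x) B"

text \<open>If \<open>S x C\<close> is not integrable in \<open>x\<close>, the Bochner integral below is \<open>0\<close> by convention. This is
  why \<^const>\<open>variation\<close> is a supremum over partitions: it then remains a subadditive functional of
  the set function even when that set function fails to be countably additive.\<close>

definition kernel_comp ::
    "('a \<Rightarrow> 'b set \<Rightarrow> real) \<Rightarrow> ('t \<Rightarrow> 'a measure) \<Rightarrow> 't \<Rightarrow> 'b set \<Rightarrow> real" where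
  "kernel_comp S U \<theta> C = (\<integral>x. S x C \<partial>U \<theta>)"

definition kernel_dist ::
    "'a measure \<Rightarrow> 'b measure \<Rightarrow> ('a \<Rightarrow> 'b set \<Rightarrow> real) \<Rightarrow> ('a \<Rightarrow> 'b set \<Rightarrow> real) \<Rightarrow> ennreal" where
  "kernel_dist X Y S S' = (SUP x\<in>space X. variation Y (\<lambda>B. S x B - S' x B) (space Y) / 2)"

definition signed_deficiency ::
    "'t measure \<Rightarrow> 'b measure \<Rightarrow> ('t \<Rightarrow> 'a measure) \<Rightarrow> ('t \<Rightarrow> 'b measure) \<Rightarrow>
     ('a \<Rightarrow> 'b set \<Rightarrow> real) \<Rightarrow> ennreal" where
  "signed_deficiency \<Theta> Y U V S = kernel_dist \<Theta> Y (set_kernel V) (kernel_comp S U)"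

definition normalized_pos_kernel :: "'b measure \<Rightarrow> ('a \<Rightarrow> 'b set \<Rightarrow> real) \<Rightarrow> 'a \<Rightarrow> 'b set \<Rightarrow> real" where
  "normalized_pos_kernel Y S x C = measure (pos_part Y (S x)) C / pos_mass Y (S x)"


text \<open>\<open>f\<close> is a version of the Radon-Nikodym derivative of \<open>\<nu>\<close> with respect to \<open>\<mu>\<close>. A version is
  used rather than \<^const>\<open>RN_deriv\<close> because the algorithm, and the pointwise bound on the
  derivative, depend on its values at every point.\<close>

definition is_RN_deriv :: "'a measure \<Rightarrow> 'a measure \<Rightarrow> ('a \<Rightarrow> real) \<Rightarrow> bool" where
  "is_RN_deriv \<mu> \<nu> f \<longleftrightarrow>
     f \<in> borel_measurable \<mu> \<and> (\<forall>y\<in>space \<mu>. 0 \<le> f y) \<and> density \<mu> (\<lambda>y. ennreal (f y)) = \<nu>"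


text \<open>The rejection sampler reads its randomness from a tape: \<open>\<omega> t = (U\<^sub>t, Y\<^sub>t)\<close> is the pair drawn in
  iteration \<open>t\<close>. The function \<open>g\<close> is \<open>y \<mapsto> dS/dP(y|x)\<close>, with \<open>S\<close> the positive part, for the given
  input \<open>x\<close>. The field \<open>cost\<close> accumulates the running time: \<open>c\<close> for the initialization, and in each
  iteration \<open>Tsamp\<close> for the draw of \<open>Y\<^sub>t\<close>, \<open>Teval\<close> for the evaluation of \<open>g\<close>, and \<open>c\<close> for everything
  else.\<close>

record 'y rk_state =
  iter :: nat
  val :: 'y
  is_set :: bool
  cost :: real

definition rk_init :: "real \<Rightarrow> 'y \<Rightarrow> 'y rk_state" where
  "rk_init c y0 = \<lparr>iter = 0, val = y0, is_set = False, cost = c\<rparr>"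

definition rk_step ::
    "real \<Rightarrow> real \<Rightarrow> real \<Rightarrow> ('y \<Rightarrow> real) \<Rightarrow> real \<Rightarrow> (nat \<Rightarrow> real \<times> 'y) \<Rightarrow> 'y rk_state \<Rightarrow> 'y rk_state" where
  "rk_step c Tsamp Teval g M \<omega> s =
     (let u = fst (\<omega> (iter s)); y = snd (\<omega> (iter s)); accept = (u \<le> 1 / M * g y)
      in \<lparr>iter = iter s + 1,
          val = (if accept then y else val s),
          is_set = (is_set s \<or> accept),
          cost = cost s + Tsamp + Teval + c\<rparr>)"

definition rk_run ::
    "real \<Rightarrow> real \<Rightarrow> real \<Rightarrow> ('y \<Rightarrow> real) \<Rightarrow> nat \<Rightarrow> real \<Rightarrow> 'y \<Rightarrow> (nat \<Rightarrow> real \<times> 'y) \<Rightarrow> 'y rk_state" where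
  "rk_run c Tsamp Teval g N M y0 \<omega> =
     while (\<lambda>s. \<not> (is_set s \<or> iter s \<ge> N + 1)) (rk_step c Tsamp Teval g M \<omega>) (rk_init c y0)"

definition rk_time ::
    "real \<Rightarrow> real \<Rightarrow> real \<Rightarrow> ('y \<Rightarrow> real) \<Rightarrow> nat \<Rightarrow> real \<Rightarrow> 'y \<Rightarrow> (nat \<Rightarrow> real \<times> 'y) \<Rightarrow> real" where
  "rk_time c Tsamp Teval g N M y0 \<omega> = cost (rk_run c Tsamp Teval g N M y0 \<omega>)"

text \<open>The output does not depend on the cost parameters, which are therefore set to \<open>0\<close>.\<close>

definition rk_output ::
    "('y \<Rightarrow> real) \<Rightarrow> nat \<Rightarrow> real \<Rightarrow> 'y \<Rightarrow> (nat \<Rightarrow> real \<times> 'y) \<Rightarrow> 'y" where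
  "rk_output g N M y0 \<omega> = val (rk_run 0 0 0 g N M y0 \<omega>)"

definition rk_tape :: "'y measure \<Rightarrow> (nat \<Rightarrow> real \<times> 'y) measure" where
  "rk_tape \<mu> = PiM UNIV (\<lambda>t::nat. uniform_measure lborel {0..1} \<Otimes>\<^sub>M \<mu>)"

definition rk_law ::
    "'y measure \<Rightarrow> ('x \<Rightarrow> 'y measure) \<Rightarrow> ('x \<Rightarrow> 'y \<Rightarrow> real) \<Rightarrow> nat \<Rightarrow> real \<Rightarrow> 'y \<Rightarrow> 'x \<Rightarrow> 'y measure" where
  "rk_law Y P r N M y0 x = distr (rk_tape (P x)) Y (rk_output (r x) N M y0)"

text \<open>Law of the output when the input has law \<open>\<mu>\<close> and the tape is drawn afresh given the input.\<close>

definition rk_law_random_input ::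
    "'y measure \<Rightarrow> ('x \<Rightarrow> 'y measure) \<Rightarrow> ('x \<Rightarrow> 'y \<Rightarrow> real) \<Rightarrow> nat \<Rightarrow> real \<Rightarrow> 'y \<Rightarrow> 'x measure \<Rightarrow> 'y measure" where
  "rk_law_random_input Y P r N M y0 \<mu> = \<mu> \<bind> rk_law Y P r N M y0"

end

(* Each iteration accepts with probability p(x)/M, and conditionally on acceptance the sample has law
   T(.|x). Hence, with w(x) = (1 - p(x)/M)^(N+1) <= exp(-N p(x)/M), the output law on input x is
   (1 - w(x)) T(.|x) + w(x) delta_{y0}; averaging over x keeps it within sup_x w(x) of T o U, and the
   triangle inequality through T o U and S o U gives the first bound. The second follows from
   S = p T - (negative part), so that |S - T| <= |p - 1| T + (negative part).
   Averaging needs p(x) and T(C|x) to be measurable in x. The positive part of S(.|x) on C is the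
   supremum of S(B|x) over measurable B <= C, and on a standard Borel space countably many B suffice. *)

theory Submission
  imports Defs
begin

subsection \<open>The Jordan decomposition of a finite signed measure\<close>

text \<open>The positive part enters through a definite description, so nothing is known about it
  until existence and uniqueness are settled. An explicit formula does both: the supremum over
  measurable subsets is shown to be a measure, and every Jordan decomposition is shown to obey it.
  Two gaps in the data shape the rest. \<open>P x\<close> and \<open>r x\<close> are constrained
  separately for each input, with no measurability in \<open>x\<close>; averaging the output law is
  still possible because its closed form depends on \<open>x\<close> only through the mass and the
  normalized positive part. And \<open>S x B\<close> need not be integrable under
  \<open>U \<theta>\<close>, so \<open>kernel_comp S U\<close> may take default values; the triangle
  inequality is therefore proved for arbitrary set functions, and integrability is derived only
  where the last error term is finite. The guard of the loop admits \<open>N + 1\<close> draws; one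
  of them is given up to obtain the exponent \<open>N\<close>. The factor 2 adds the masses of the
  point mass at \<open>y0\<close> and of the normalized kernel.\<close>

lemma signed_measureD:
  assumes "signed_measure M \<mu>"
  shows "\<mu> {} = 0"
    and "\<And>A::nat \<Rightarrow> 'a set. range A \<subseteq> sets M \<Longrightarrow> disjoint_family A \<Longrightarrow> (\<lambda>i. \<mu> (A i)) sums \<mu> (\<Union>i. A i)"
  using assms unfolding signed_measure_def by auto

lemma signed_measure_Un:
  assumes "signed_measure M \<mu>" "A \<in> sets M" "B \<in> sets M" "A \<inter> B = {}"
  shows "\<mu> (A \<union> B) = \<mu> A + \<mu> B"
proof -
  have "(\<lambda>i. \<mu> (binaryset A B i)) sums \<mu> (\<Union>i. binaryset A B i)"
    using assms by (intro signed_measureD(2)[of M \<mu>])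
      (auto simp: range_binaryset_eq disjoint_family_on_def binaryset_def)
  moreover have "(\<lambda>i. \<mu> (binaryset A B i)) sums (\<mu> A + \<mu> B)"
    using assms by (intro binaryset_sums) (auto dest: signed_measureD)
  ultimately show ?thesis
    by (simp add: sums_iff UN_binaryset_eq)
qed

lemma signed_measure_Diff:
  assumes "signed_measure M \<mu>" "A \<in> sets M" "B \<in> sets M" "B \<subseteq> A"
  shows "\<mu> (A - B) = \<mu> A - \<mu> B"
proof -
  have "\<mu> (B \<union> (A - B)) = \<mu> B + \<mu> (A - B)"
    using assms by (intro signed_measure_Un) auto
  moreover have "B \<union> (A - B) = A" using assms by auto
  ultimately show ?thesis by simp
qed

lemma signed_measure_bounded_above:
  assumes \<mu>: "signed_measure M \<mu>"
  obtains K where "\<And>B. B \<in> sets M \<Longrightarrow> \<mu> B \<le> K"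
proof -
  \<comment> \<open>A set on which \<open>\<mu>\<close> is unbounded above splits into one piece of mass at least \<open>1\<close> in absolute value
    and one on which \<open>\<mu>\<close> is again unbounded; iterating contradicts the convergence required of a
    countable disjoint union.\<close>
  define unb where "unb E \<longleftrightarrow> (\<forall>k. \<exists>B\<in>sets M. B \<subseteq> E \<and> k < \<mu> B)" for E
  have split: "unb B \<or> unb (E - B)" if "unb E" "B \<in> sets M" "E \<in> sets M" for E B
  proof (rule ccontr)
    assume "\<not> ?thesis"
    then obtain k1 k2 where k: "\<And>C. C \<in> sets M \<Longrightarrow> C \<subseteq> B \<Longrightarrow> \<mu> C \<le> k1"
      "\<And>C. C \<in> sets M \<Longrightarrow> C \<subseteq> E - B \<Longrightarrow> \<mu> C \<le> k2"
      unfolding unb_def by (meson not_less)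
    from \<open>unb E\<close> obtain C where C: "C \<in> sets M" "C \<subseteq> E" "k1 + k2 < \<mu> C"
      unfolding unb_def by blast
    have "\<mu> ((C \<inter> B) \<union> (C - B)) = \<mu> (C \<inter> B) + \<mu> (C - B)"
      using C that by (intro signed_measure_Un[OF \<mu>]) auto
    also have "(C \<inter> B) \<union> (C - B) = C" by auto
    finally show False
      using k(1)[of "C \<inter> B"] k(2)[of "C - B"] C that by fastforce
  qed
  have step: "\<exists>E'. (E' \<in> sets M \<and> unb E') \<and> (E' \<subseteq> E \<and> 1 \<le> \<bar>\<mu> (E - E')\<bar>)"
    if E: "E \<in> sets M \<and> unb E" for E
  proof -
    \<comment> \<open>The threshold \<open>1 + \<bar>\<mu> E\<bar>\<close> makes either piece
      discardable: \<open>\<mu> B > 1\<close>, and \<open>\<bar>\<mu> (E - B)\<bar> \<ge> \<mu> B -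
      \<bar>\<mu> E\<bar> > 1\<close>. The piece on which \<open>\<mu>\<close> stays unbounded is
      kept.\<close>
    from E obtain B where B: "B \<in> sets M" "B \<subseteq> E" "1 + \<bar>\<mu> E\<bar> < \<mu> B"
      unfolding unb_def by blast
    have d: "\<mu> (E - B) = \<mu> E - \<mu> B" using E B by (intro signed_measure_Diff[OF \<mu>]) auto
    have "E - (E - B) = B" using B by auto
    then show ?thesis
      using split[of E B] E B d
      by (cases "unb B") (force intro: exI[of _ B], force intro: exI[of _ "E - B"])
  qed
  have "\<not> unb (space M)"
  proof
    assume "unb (space M)"
    then have "\<exists>E. \<forall>n::nat. (E n \<in> sets M \<and> unb (E n)) \<and> (E (Suc n) \<subseteq> E n \<and> 1 \<le> \<bar>\<mu> (E n - E (Suc n))\<bar>)"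
      using step by (intro dependent_nat_choice) auto
    then obtain E where E: "\<And>n::nat. E n \<in> sets M" "\<And>n. E (Suc n) \<subseteq> E n"
      "\<And>n. 1 \<le> \<bar>\<mu> (E n - E (Suc n))\<bar>" by blast
    have anti: "E n \<subseteq> E m" if "m \<le> n" for m n
      using that E(2) by (rule lift_Suc_antimono_le[rotated])
    have "disjoint_family (\<lambda>n. E n - E (Suc n))"
      unfolding disjoint_family_on_def
    proof (intro ballI impI)
      fix m n :: nat assume "m \<noteq> n"
      then show "(E m - E (Suc m)) \<inter> (E n - E (Suc n)) = {}"
        using anti[of "Suc m" n] anti[of "Suc n" m] by (cases "m < n") auto
    qed
    then have "(\<lambda>n. \<mu> (E n - E (Suc n))) sums \<mu> (\<Union>n. E n - E (Suc n))"
      using E(1) by (intro signed_measureD(2)[OF \<mu>]) auto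
    then have "(\<lambda>n. \<mu> (E n - E (Suc n))) \<longlonglongrightarrow> 0"
      by (intro summable_LIMSEQ_zero sums_summable)
    then have "eventually (\<lambda>n. \<bar>\<mu> (E n - E (Suc n))\<bar> < 1) sequentially"
      by (auto dest!: tendstoD[where e=1])
    then show False
      unfolding eventually_sequentially using E(3) by (meson less_le_not_le order_refl)
  qed
  then obtain K where "\<And>B. B \<in> sets M \<Longrightarrow> B \<subseteq> space M \<Longrightarrow> \<mu> B \<le> K"
    unfolding unb_def by (meson not_less)
  then show thesis by (intro that[of K]) (auto dest: sets.sets_into_space)
qed

text \<open>This is the classical formula for the positive part. The truncation of negative values
  by \<open>ennreal\<close> is harmless, since the empty set always competes with value 0.\<close>

definition upper_variation :: "'a measure \<Rightarrow> ('a set \<Rightarrow> real) \<Rightarrow> 'a set \<Rightarrow> ennreal" where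
  "upper_variation M \<mu> A = (SUP B\<in>{B\<in>sets M. B \<subseteq> A}. ennreal (\<mu> B))"

text \<open>Competitors inside disjoint sets unite to a competitor for the union. When one of the
  two values is negative, \<open>ennreal\<close> truncates it and additivity fails; the other
  competitor alone then suffices.\<close>

lemma upper_variation_superadditive:
  assumes \<mu>: "signed_measure M \<mu>" and "A \<in> sets M" "A' \<in> sets M" "A \<inter> A' = {}"
  shows "upper_variation M \<mu> A + upper_variation M \<mu> A' \<le> upper_variation M \<mu> (A \<union> A')"
proof -
  have *: "ennreal (\<mu> B) + ennreal (\<mu> B') \<le> upper_variation M \<mu> (A \<union> A')"
    if "B \<in> sets M" "B' \<in> sets M" "B \<subseteq> A" "B' \<subseteq> A'" for B B'
  proof -
    have le: "ennreal (\<mu> C) \<le> upper_variation M \<mu> (A \<union> A')" if "C \<in> sets M" "C \<subseteq> A \<union> A'" for C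
      using that unfolding upper_variation_def by (auto intro: SUP_upper2)
    have "\<mu> (B \<union> B') = \<mu> B + \<mu> B'"
      using that assms by (intro signed_measure_Un) auto
    then show ?thesis
      using le[of B] le[of B'] le[of "B \<union> B'"] that
      by (cases "\<mu> B \<ge> 0"; cases "\<mu> B' \<ge> 0") (auto simp: ennreal_neg ennreal_plus[symmetric] simp del: ennreal_plus)
  qed
  have ne: "{B \<in> sets M. B \<subseteq> A} \<noteq> {}" "{B \<in> sets M. B \<subseteq> A'} \<noteq> {}" by auto
  show ?thesis
    unfolding upper_variation_def[of _ _ A] upper_variation_def[of _ _ A']
    unfolding ennreal_SUP_add_left[OF ne(1), symmetric] ennreal_SUP_add_right[OF ne(2)]
    by (intro SUP_least) (use * in auto)
qed

text \<open>One inequality is finite superadditivity followed by monotonicity. For the other, a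
  competitor for the union is cut along the \<open>A i\<close>, and countable additivity of
  \<open>\<mu>\<close> recovers its value from the pieces.\<close>

lemma upper_variation_countably_additive:
  assumes \<mu>: "signed_measure M \<mu>"
  shows "countably_additive (sets M) (upper_variation M \<mu>)"
proof (rule countably_additiveI)
  fix A :: "nat \<Rightarrow> 'a set"
  assume A: "range A \<subseteq> sets M" "disjoint_family A" "\<Union> (range A) \<in> sets M"
  let ?\<nu> = "upper_variation M \<mu>"
  show "(\<Sum>i. ?\<nu> (A i)) = ?\<nu> (\<Union> (range A))"
  proof (rule antisym)
    have 1: "(\<Sum>i<n. ?\<nu> (A i)) \<le> ?\<nu> (\<Union>i<n. A i)" for n
    proof (induction n)
      case (Suc n)
      have "(\<Sum>i<Suc n. ?\<nu> (A i)) \<le> ?\<nu> (\<Union>i<n. A i) + ?\<nu> (A n)"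
        using Suc by (auto intro: add_right_mono)
      also have "\<dots> \<le> ?\<nu> ((\<Union>i<n. A i) \<union> A n)"
      proof (rule upper_variation_superadditive[OF \<mu>])
        show "(\<Union>i<n. A i) \<inter> A n = {}"
          using disjoint_family_onD[OF A(2)] by (auto simp: set_eq_iff) (metis nat_neq_iff)
      qed (use A in auto)
      finally show ?case by (simp add: lessThan_Suc Un_commute)
    qed simp
    have 2: "?\<nu> (\<Union>i<n. A i) \<le> ?\<nu> (\<Union> (range A))" for n
      unfolding upper_variation_def by (rule SUP_subset_mono) auto
    show "(\<Sum>i. ?\<nu> (A i)) \<le> ?\<nu> (\<Union> (range A))"
      by (rule suminf_le_const[OF summableI]) (rule order_trans[OF 1 2])
  next
    show "?\<nu> (\<Union> (range A)) \<le> (\<Sum>i. ?\<nu> (A i))"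
      unfolding upper_variation_def[of _ _ "\<Union> (range A)"]
    proof (rule SUP_least, clarify)
      fix B assume B: "B \<in> sets M" "B \<subseteq> \<Union> (range A)"
      have "(\<lambda>i. \<mu> (B \<inter> A i)) sums \<mu> (\<Union>i. B \<inter> A i)"
        using A B by (intro signed_measureD(2)[OF \<mu>]) (auto simp: disjoint_family_on_def)
      also have "(\<Union>i. B \<inter> A i) = B" using B by auto
      finally have "(\<lambda>n. ennreal (\<Sum>i<n. \<mu> (B \<inter> A i))) \<longlonglongrightarrow> ennreal (\<mu> B)"
        unfolding sums_def by (intro tendsto_ennrealI)
      then show "ennreal (\<mu> B) \<le> (\<Sum>i. ?\<nu> (A i))"
      proof (rule LIMSEQ_le_const2, intro exI allI impI)
        fix n
        \<comment> \<open>Summands may be negative, and \<open>ennreal\<close> commutes with sums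
          only for nonnegative ones; hence the passage through \<open>max 0\<close>.\<close>
        have "ennreal (\<Sum>i<n. \<mu> (B \<inter> A i)) \<le> ennreal (\<Sum>i<n. max 0 (\<mu> (B \<inter> A i)))"
          by (intro ennreal_leI sum_mono) auto
        also have "\<dots> = (\<Sum>i<n. ennreal (max 0 (\<mu> (B \<inter> A i))))"
          by (rule sum_ennreal[symmetric]) simp
        also have "\<dots> = (\<Sum>i<n. ennreal (\<mu> (B \<inter> A i)))" by (simp only: ennreal_max_0)
        also have "\<dots> \<le> (\<Sum>i<n. ?\<nu> (A i))"
          unfolding upper_variation_def using A B by (intro sum_mono SUP_upper) auto
        also have "\<dots> \<le> (\<Sum>i. ?\<nu> (A i))"
          by (intro sum_le_suminf) auto
        finally show "ennreal (\<Sum>i<n. \<mu> (B \<inter> A i)) \<le> (\<Sum>i. ?\<nu> (A i))" .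
      qed
    qed
  qed
qed

text \<open>On such a set \<open>\<mu>\<close> is monotone, because \<open>H - B\<close> has
  nonnegative value too; so the supremum is attained at \<open>H\<close> itself.\<close>

lemma upper_variation_eq_of_subsets_nonneg:
  assumes \<mu>: "signed_measure M \<mu>" and H: "H \<in> sets M" "\<And>B. B \<in> sets M \<Longrightarrow> B \<subseteq> H \<Longrightarrow> 0 \<le> \<mu> B"
  shows "upper_variation M \<mu> H = ennreal (\<mu> H)"
  unfolding upper_variation_def
proof (rule antisym)
  show "(SUP B\<in>{B \<in> sets M. B \<subseteq> H}. ennreal (\<mu> B)) \<le> ennreal (\<mu> H)"
  proof (rule SUP_least, clarify)
    fix B assume "B \<in> sets M" "B \<subseteq> H"
    then show "ennreal (\<mu> B) \<le> ennreal (\<mu> H)"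
      using signed_measure_Diff[OF \<mu> H(1), of B] H(2)[of "H - B"] H(1) by (intro ennreal_leI) auto
  qed
qed (use H in \<open>auto intro: SUP_upper\<close>)

text \<open>The upper variation is finite because \<open>\<mu>\<close> is bounded above, and it
  serves as positive part; the negative part is its excess over \<open>\<mu>\<close>. Mutual
  singularity is then read off from a Hahn set of these two measures.\<close>

lemma jordan_decomposition_exists:
  assumes \<mu>: "signed_measure M \<mu>"
  obtains \<mu>p \<mu>n where "is_jordan_decomposition M \<mu> \<mu>p \<mu>n"
proof -
  let ?\<nu> = "upper_variation M \<mu>"
  obtain K where K: "\<And>B. B \<in> sets M \<Longrightarrow> \<mu> B \<le> K"
    using signed_measure_bounded_above[OF \<mu>] by blast
  have fin: "?\<nu> A < \<infinity>" for A
  proof -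
    have "?\<nu> A \<le> ennreal K" unfolding upper_variation_def
      using K by (intro SUP_least ennreal_leI) auto
    then show ?thesis using le_less_trans by fastforce
  qed
  define \<mu>p where "\<mu>p = measure_of (space M) (sets M) ?\<nu>"
  have sp[simp]: "sets \<mu>p = sets M" "space \<mu>p = space M"
    unfolding \<mu>p_def by auto
  have ep: "emeasure \<mu>p A = ?\<nu> A" if "A \<in> sets M" for A
  unfolding \<mu>p_def
  proof (rule emeasure_measure_of_sigma)
    show "positive (sets M) ?\<nu>"
      using signed_measureD[OF \<mu>] by (auto simp: positive_def upper_variation_def)
  qed (use that upper_variation_countably_additive[OF \<mu>] sets.sigma_algebra_axioms in auto)
  interpret p: finite_measure \<mu>p
    by (rule finite_measureI) (use fin in \<open>simp add: ep less_top\<close>)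
  \<comment> \<open>Nonnegative because \<open>A\<close> competes in its own supremum, and countably
    additive as a difference of two convergent series.\<close>
  define d where "d A = measure \<mu>p A - \<mu> A" for A
  have d0: "0 \<le> d A" if "A \<in> sets M" for A
  proof -
    have "ennreal (\<mu> A) \<le> emeasure \<mu>p A" unfolding ep[OF that] upper_variation_def
      using that by (auto intro: SUP_upper)
    then show ?thesis by (simp add: d_def p.emeasure_eq_measure)
  qed
  define \<mu>n where "\<mu>n = measure_of (space M) (sets M) (\<lambda>A. ennreal (d A))"
  have sn[simp]: "sets \<mu>n = sets M" "space \<mu>n = space M"
    unfolding \<mu>n_def by auto
  have en: "emeasure \<mu>n A = ennreal (d A)" if "A \<in> sets M" for A
  unfolding \<mu>n_def
  proof (rule emeasure_measure_of_sigma)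
    show "positive (sets M) (\<lambda>A. ennreal (d A))"
      using signed_measureD[OF \<mu>] by (auto simp: positive_def d_def)
    show "countably_additive (sets M) (\<lambda>A. ennreal (d A))"
    proof (rule countably_additiveI)
      fix A :: "nat \<Rightarrow> 'a set"
      assume A: "range A \<subseteq> sets M" "disjoint_family A" "\<Union> (range A) \<in> sets M"
      have "(\<lambda>i. d (A i)) sums d (\<Union> (range A))"
        unfolding d_def using A
        by (intro sums_diff signed_measureD(2)[OF \<mu>] p.finite_measure_UNION) auto
      then have "(\<lambda>i. ennreal (d (A i))) sums ennreal (d (\<Union> (range A)))"
        by (subst sums_ennreal) (use A in \<open>auto intro: d0\<close>)
      then show "(\<Sum>i. ennreal (d (A i))) = ennreal (d (\<Union> (range A)))"
        by (rule sums_unique[symmetric])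
    qed
  qed (use that sets.sigma_algebra_axioms in auto)
  interpret n: finite_measure \<mu>n
    by (rule finite_measureI) (simp add: en)
  have mn: "measure \<mu>n A = d A" if "A \<in> sets M" for A
    using en[OF that] d0[OF that] by (simp add: measure_def)
  \<comment> \<open>Since \<open>\<mu>\<close> is the difference of the two measures, comparing them
    on subsets of \<open>H\<close> and of its complement gives the sign of \<open>\<mu>\<close>
    there.\<close>
  obtain H where H: "H \<in> sets M" "\<And>A. A \<in> sets M \<Longrightarrow> A \<subseteq> H \<Longrightarrow> \<mu>n A \<le> \<mu>p A"
    "\<And>A. A \<in> sets M \<Longrightarrow> A \<inter> H = {} \<Longrightarrow> \<mu>p A \<le> \<mu>n A"
    using finite_unsigned_Hahn_decomposition[OF p.finite_measure_axioms n.finite_measure_axioms] by auto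
  have "?\<nu> H = ennreal (\<mu> H)"
  proof (rule upper_variation_eq_of_subsets_nonneg[OF \<mu> H(1)])
    fix B assume "B \<in> sets M" "B \<subseteq> H"
    then show "0 \<le> \<mu> B"
      using H(2)[of B] by (simp add: p.emeasure_eq_measure n.emeasure_eq_measure mn d_def)
  qed
  moreover have "0 \<le> \<mu> H"
    using H(1) H(2)[of H] by (simp add: p.emeasure_eq_measure n.emeasure_eq_measure mn d_def)
  ultimately have nH: "emeasure \<mu>n H = 0"
    using H(1) by (simp add: en d_def measure_def ep)
  have pH: "emeasure \<mu>p (space M - H) = 0"
  proof -
    have "\<mu> B \<le> 0" if "B \<in> sets M" "B \<subseteq> space M - H" for B
    proof -
      have "B \<inter> H = {}" using that by auto
      then show ?thesis using H(3)[of B] that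
        d0[of B] by (simp add: p.emeasure_eq_measure n.emeasure_eq_measure mn d_def)
    qed
    then have "?\<nu> (space M - H) \<le> 0"
      unfolding upper_variation_def by (intro SUP_least) (auto simp: ennreal_neg)
    then show ?thesis using H(1) by (simp add: ep)
  qed
  show thesis
  proof (rule that)
    show "is_jordan_decomposition M \<mu> \<mu>p \<mu>n"
      unfolding is_jordan_decomposition_def using H(1) nH pH mn
      by (auto simp: p.finite_measure_axioms n.finite_measure_axioms d_def)
  qed
qed

text \<open>The positive part lives on \<open>H\<close>, where it agrees with \<open>\<mu>\<close>;
  so \<open>A \<inter> H\<close> attains the supremum. As the right-hand sides mention only
  \<open>\<mu>\<close>, this is uniqueness of the decomposition.\<close>

lemma jordan_decomposition_emeasure:
  assumes j: "is_jordan_decomposition M \<mu> \<mu>p \<mu>n" and A: "A \<in> sets M"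
  shows "emeasure \<mu>p A = upper_variation M \<mu> A"
    and "emeasure \<mu>n A = ennreal (enn2real (upper_variation M \<mu> A) - \<mu> A)"
proof -
  have s[simp]: "sets \<mu>p = sets M" "sets \<mu>n = sets M" and eq: "\<And>A. A \<in> sets M \<Longrightarrow> \<mu> A = measure \<mu>p A - measure \<mu>n A"
    using j unfolding is_jordan_decomposition_def by auto
  interpret p: finite_measure \<mu>p using j by (simp add: is_jordan_decomposition_def)
  interpret n: finite_measure \<mu>n using j by (simp add: is_jordan_decomposition_def)
  obtain H where H: "H \<in> sets M" "emeasure \<mu>n H = 0" "emeasure \<mu>p (space M - H) = 0"
    using j unfolding is_jordan_decomposition_def by auto
  show *: "emeasure \<mu>p A = upper_variation M \<mu> A"
  proof (rule antisym)
    have "emeasure \<mu>p A = emeasure \<mu>p (A \<inter> H) + emeasure \<mu>p (A - H)"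
      using A H by (subst plus_emeasure) (auto intro: arg_cong[where f="emeasure \<mu>p"])
    also have "emeasure \<mu>p (A - H) = 0"
    proof (rule emeasure_eq_0[OF _ H(3)])
      show "A - H \<subseteq> space M - H" using sets.sets_into_space[OF A] by auto
    qed (use H in auto)
    also have "emeasure \<mu>n (A \<inter> H) = 0"
      using H by (intro emeasure_eq_0[OF _ H(2)]) auto
    then have "emeasure \<mu>p (A \<inter> H) = ennreal (\<mu> (A \<inter> H))"
      using A H by (simp add: eq p.emeasure_eq_measure n.emeasure_eq_measure)
    finally show "emeasure \<mu>p A \<le> upper_variation M \<mu> A"
      unfolding upper_variation_def using A H by (auto intro!: SUP_upper)
    show "upper_variation M \<mu> A \<le> emeasure \<mu>p A"
      unfolding upper_variation_def
    proof (rule SUP_least, clarify)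
      fix B assume B: "B \<in> sets M" "B \<subseteq> A"
      have "\<mu> B \<le> measure \<mu>p B" using eq[OF B(1)] by simp
      also have "\<dots> \<le> measure \<mu>p A" using B A by (intro p.finite_measure_mono) auto
      finally show "ennreal (\<mu> B) \<le> emeasure \<mu>p A"
        by (simp add: p.emeasure_eq_measure ennreal_leI)
    qed
  qed
  show "emeasure \<mu>n A = ennreal (enn2real (upper_variation M \<mu> A) - \<mu> A)"
    unfolding *[symmetric] by (simp add: eq[OF A] n.emeasure_eq_measure p.emeasure_eq_measure)
qed

text \<open>Licenses every later use of \<open>pos_part\<close> and \<open>neg_part\<close>:
  existence and uniqueness together discharge the definite description.\<close>

lemma is_jordan_decomposition_parts:
  assumes \<mu>: "signed_measure M \<mu>"
  shows "is_jordan_decomposition M \<mu> (pos_part M \<mu>) (neg_part M \<mu>)"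
proof -
  obtain \<mu>p \<mu>n where j: "is_jordan_decomposition M \<mu> \<mu>p \<mu>n"
    using jordan_decomposition_exists[OF \<mu>] by blast
  have "is_jordan_decomposition M \<mu> (fst (jordan_decomposition M \<mu>)) (snd (jordan_decomposition M \<mu>))"
    unfolding jordan_decomposition_def
  proof (rule theI[where a="(\<mu>p, \<mu>n)"])
    fix d assume d: "is_jordan_decomposition M \<mu> (fst d) (snd d)"
    have "sets (fst d) = sets M" "sets (snd d) = sets M" "sets \<mu>p = sets M" "sets \<mu>n = sets M"
      using j d unfolding is_jordan_decomposition_def by auto
    then have "fst d = \<mu>p" "snd d = \<mu>n"
      by (auto intro!: measure_eqI simp: jordan_decomposition_emeasure[OF j] jordan_decomposition_emeasure[OF d])
    then show "d = (\<mu>p, \<mu>n)" by (cases d) auto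
  qed (use j in simp)
  then show ?thesis unfolding pos_part_def neg_part_def .
qed

subsection \<open>Measurability of the positive part of a kernel\<close>

text \<open>The closure under union and complement is built in countable stages \<open>F n\<close>.
  The stages increase, so two members of their union share a stage and their union appears at the
  next one. Staying inside \<open>sigma_sets\<close> ensures that no new sets are generated.\<close>

lemma countable_algebra_cover:
  assumes "countable \<B>" "\<B> \<subseteq> Pow \<Omega>"
  obtains \<A> where "countable \<A>" "algebra \<Omega> \<A>" "\<B> \<subseteq> \<A>" "\<A> \<subseteq> sigma_sets \<Omega> \<B>"
proof -
  define F where "F = rec_nat (insert {} \<B>)
    (\<lambda>_ G. G \<union> (\<lambda>(A, B). A \<union> B) ` (G \<times> G) \<union> (\<lambda>A. \<Omega> - A) ` G)"
  have F0: "F 0 = insert {} \<B>" and FS: "F (Suc n) = F n \<union> (\<lambda>(A, B). A \<union> B) ` (F n \<times> F n) \<union> (\<lambda>A. \<Omega> - A) ` F n" for n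
    by (simp_all add: F_def)
  have mono: "F m \<subseteq> F n" if "m \<le> n" for m n
    using that by (rule lift_Suc_mono_le[rotated]) (auto simp: FS)
  show thesis
  proof (rule that[of "\<Union>n. F n"])
    have "countable (F n)" for n
      by (induction n) (use assms in \<open>auto simp: F0 FS\<close>)
    then show "countable (\<Union>n. F n)" by auto
    have ss: "F n \<subseteq> sigma_sets \<Omega> \<B>" for n
    proof (induction n)
      case 0
      show ?case by (auto simp: F0 intro: sigma_sets.intros)
    next
      case (Suc n)
      then show ?case by (auto simp: FS intro!: sigma_sets_Un intro: sigma_sets.Compl)
    qed
    then show "(\<Union>n. F n) \<subseteq> sigma_sets \<Omega> \<B>" by auto
    show "\<B> \<subseteq> (\<Union>n. F n)" using F0 by auto
    show "algebra \<Omega> (\<Union>n. F n)"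
      unfolding algebra_iff_Un
    proof (intro conjI ballI)
      show "(\<Union>n. F n) \<subseteq> Pow \<Omega>" using ss sigma_sets_into_sp[OF assms(2)] by blast
      show "{} \<in> (\<Union>n. F n)" using F0 by auto
    next
      fix a assume "a \<in> (\<Union>n. F n)"
      then obtain n where "a \<in> F n" by auto
      then have "\<Omega> - a \<in> F (Suc n)" by (auto simp: FS)
      then show "\<Omega> - a \<in> (\<Union>n. F n)" by blast
    next
      fix a b assume "a \<in> (\<Union>n. F n)" "b \<in> (\<Union>n. F n)"
      then obtain m n where "a \<in> F m" "b \<in> F n" by auto
      then have "a \<in> F (max m n)" "b \<in> F (max m n)"
        using mono[of m "max m n"] mono[of n "max m n"] by auto
      then have "a \<union> b \<in> F (Suc (max m n))" by (auto simp: FS)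
      then show "a \<union> b \<in> (\<Union>n. F n)" by blast
    qed
  qed
qed

text \<open>Every open set is a countable union of members of a countable base, so the base, and
  hence the algebra around it, generates the Borel sets.\<close>

lemma standard_borel_countable_algebra:
  assumes "standard_borel M"
  obtains \<A> where "countable \<A>" "algebra (space M) \<A>" "sets M = sigma_sets (space M) \<A>"
proof -
  from assms obtain T where T: "second_countable T" "topspace T = space M"
    "sets M = sigma_sets (space M) {G. openin T G}"
    unfolding standard_borel_def by auto
  then obtain \<B> where B: "countable \<B>" "\<And>V. V \<in> \<B> \<Longrightarrow> openin T V"
    "\<And>U x. openin T U \<Longrightarrow> x \<in> U \<Longrightarrow> \<exists>V\<in>\<B>. x \<in> V \<and> V \<subseteq> U"
    unfolding second_countable_def by metis
  have "\<B> \<subseteq> Pow (space M)" using B(2) T(2) openin_subset by fastforce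
  from countable_algebra_cover[OF B(1) this]
  obtain \<A> where A: "countable \<A>" "algebra (space M) \<A>" "\<B> \<subseteq> \<A>" "\<A> \<subseteq> sigma_sets (space M) \<B>"
    by blast
  have "sets M = sigma_sets (space M) \<A>"
  proof (rule antisym)
    have "U \<in> sigma_sets (space M) \<A>" if "openin T U" for U
    proof -
      have "U = \<Union>{V\<in>\<B>. V \<subseteq> U}" using B(3)[OF that] by blast
      moreover have "\<Union>{V\<in>\<B>. V \<subseteq> U} \<in> sigma_sets (space M) \<A>"
      proof (rule sigma_algebra.countable_Union[OF sigma_algebra_sigma_sets])
        show "\<A> \<subseteq> Pow (space M)" using A(2) by (simp add: algebra_iff_Un)
        show "countable {V\<in>\<B>. V \<subseteq> U}" using B(1) by (rule countable_subset[rotated]) auto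
        show "{V\<in>\<B>. V \<subseteq> U} \<subseteq> sigma_sets (space M) \<A>" using A(3) by (auto intro!: sigma_sets.Basic)
      qed
      ultimately show ?thesis by simp
    qed
    then show "sets M \<subseteq> sigma_sets (space M) \<A>"
      unfolding T(3) by (intro sigma_sets_mono) auto
    have "\<B> \<subseteq> sets M" unfolding T(3) using B(2) by (auto intro!: sigma_sets.Basic)
    then have "sigma_sets (space M) \<B> \<subseteq> sets M" by (rule sets.sigma_sets_subset)
    then show "sigma_sets (space M) \<A> \<subseteq> sets M"
      using A(4) by (intro sets.sigma_sets_subset) auto
  qed
  with A show thesis using that by blast
qed

text \<open>The approximable sets contain the algebra and form a sigma-algebra: complementing both
  sets preserves their symmetric difference, and a countable union is approximated through a finite
  part of it.\<close>

lemma (in finite_measure) algebra_approximation: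
  assumes alg: "algebra (space M) \<A>" and gen: "sets M = sigma_sets (space M) \<A>"
    and "B \<in> sets M" "0 < e"
  shows "\<exists>D\<in>\<A>. measure M ((B - D) \<union> (D - B)) < e"
  using assms(3,4) unfolding gen
proof (induction arbitrary: e rule: sigma_sets.induct)
  interpret algebra "space M" \<A> by fact
  have A_sets[simp]: "D \<in> sets M" if "D \<in> \<A>" for D using that gen by auto
  {
    case (Basic a)
    then show ?case by (auto intro!: bexI[of _ a])
  next
    case Empty
    then show ?case by (auto intro!: bexI[of _ "{}"])
  next
    case (Compl a)
    obtain D where D: "D \<in> \<A>" "measure M ((a - D) \<union> (D - a)) < e"
      using Compl.IH[OF Compl.prems] by blast
    have "a \<subseteq> space M" "D \<subseteq> space M"
      using Compl.hyps D(1) space_closed gen sets.sets_into_space[of a M] by auto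
    then have "(space M - a - (space M - D)) \<union> (space M - D - (space M - a)) = (a - D) \<union> (D - a)"
      by auto
    then show ?case using D by (intro bexI[of _ "space M - D"]) auto
  next
    case (Union a)
    have [measurable]: "a i \<in> sets M" for i using Union.hyps gen by auto
    let ?U = "\<Union>i. a i"
    \<comment> \<open>The remainders decrease to the empty set, so finitely many \<open>a i\<close>
      exhaust the union up to \<open>e / 2\<close>.\<close>
    have "(\<lambda>n. measure M (?U - (\<Union>i<n. a i))) \<longlonglongrightarrow> measure M (\<Inter>n. ?U - (\<Union>i<n. a i))"
      by (rule finite_Lim_measure_decseq) (auto simp: decseq_def)
    also have "(\<Inter>n. ?U - (\<Union>i<n. a i)) = {}" by auto
    finally have "eventually (\<lambda>n. measure M (?U - (\<Union>i<n. a i)) < e / 2) sequentially"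
      using Union.prems by (intro order_tendstoD(2)) auto
    then obtain n where n: "measure M (?U - (\<Union>i<n. a i)) < e / 2"
      by (auto simp: eventually_sequentially)
    \<comment> \<open>The \<open>n\<close> errors add up to at most the other \<open>e / 2\<close>;
      writing \<open>n + 1\<close> keeps the tolerance positive for \<open>n = 0\<close>.\<close>
    have "\<exists>D\<in>\<A>. measure M ((a i - D) \<union> (D - a i)) < e / (2 * (n + 1))" for i
      using Union.prems by (intro Union.IH) auto
    then obtain D where D: "\<And>i. D i \<in> \<A>"
      "\<And>i. measure M ((a i - D i) \<union> (D i - a i)) < e / (2 * (n + 1))"
      by metis
    have [measurable]: "D i \<in> sets M" for i using D(1) by simp
    let ?D = "\<Union>i<n. D i"
    have "measure M ((?U - ?D) \<union> (?D - ?U))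
        \<le> measure M ((?U - (\<Union>i<n. a i)) \<union> (\<Union>i<n. (a i - D i) \<union> (D i - a i)))"
      by (intro finite_measure_mono) (auto, measurable)
    also have "\<dots> \<le> measure M (?U - (\<Union>i<n. a i)) + measure M (\<Union>i<n. (a i - D i) \<union> (D i - a i))"
      by (intro measure_Un_le) auto
    also have "measure M (\<Union>i<n. (a i - D i) \<union> (D i - a i))
        \<le> (\<Sum>i<n. measure M ((a i - D i) \<union> (D i - a i)))"
      by (intro measure_UNION_le) auto
    also have "\<dots> \<le> (\<Sum>i<n. e / (2 * (n + 1)))"
      using D(2) by (intro sum_mono less_imp_le)
    also have "\<dots> \<le> e / 2"
      using Union.prems by (simp add: field_simps)
    finally show ?case
      using n D(1) by (intro bexI[of _ ?D]) auto
  }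
qed

text \<open>The sum of positive and negative part works. A genuine finite measure is wanted because
  approximation by an algebra is available only for those.\<close>

lemma signed_measure_dominated:
  assumes \<mu>: "signed_measure M \<mu>"
  obtains m where "finite_measure m" "sets m = sets M" "\<And>A. A \<in> sets M \<Longrightarrow> \<bar>\<mu> A\<bar> \<le> measure m A"
proof -
  let ?p = "pos_part M \<mu>" and ?n = "neg_part M \<mu>"
  have j: "is_jordan_decomposition M \<mu> ?p ?n" by (rule is_jordan_decomposition_parts[OF \<mu>])
  have s[simp]: "sets ?p = sets M" "sets ?n = sets M" and eq: "\<And>A. A \<in> sets M \<Longrightarrow> \<mu> A = measure ?p A - measure ?n A"
    using j unfolding is_jordan_decomposition_def by auto
  interpret p: finite_measure ?p using j by (simp add: is_jordan_decomposition_def)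
  interpret n: finite_measure ?n using j by (simp add: is_jordan_decomposition_def)
  define m where "m = measure_of (space M) (sets M) (\<lambda>A. emeasure ?p A + emeasure ?n A)"
  have sm[simp]: "sets m = sets M" "space m = space M" unfolding m_def by auto
  have em: "emeasure m A = emeasure ?p A + emeasure ?n A" if "A \<in> sets M" for A
    unfolding m_def
  proof (rule emeasure_measure_of_sigma)
    show "countably_additive (sets M) (\<lambda>A. emeasure ?p A + emeasure ?n A)"
      by (auto simp: countably_additive_def suminf_add[symmetric] suminf_emeasure)
  qed (use that sets.sigma_algebra_axioms in \<open>auto simp: positive_def\<close>)
  interpret m: finite_measure m
    by (rule finite_measureI) (simp add: em p.emeasure_eq_measure n.emeasure_eq_measure)
  show thesis
  proof (rule that[OF m.finite_measure_axioms])
    fix A assume A: "A \<in> sets M"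
    have "measure m A = measure ?p A + measure ?n A"
      using em[OF A] by (simp add: p.emeasure_eq_measure n.emeasure_eq_measure m.emeasure_eq_measure flip: ennreal_plus)
    then show "\<bar>\<mu> A\<bar> \<le> measure m A" using eq[OF A] measure_nonneg[of ?p A] measure_nonneg[of ?n A] by linarith
  qed simp
qed

text \<open>A countable generating algebra suffices in the supremum, because it is dense in \<^term>\<open>sets M\<close> for
  the variation measure. This makes the positive part measurable in the kernel parameter.\<close>

lemma upper_variation_eq_SUP_algebra:
  assumes \<mu>: "signed_measure M \<mu>" and alg: "algebra (space M) \<A>"
    and gen: "sets M = sigma_sets (space M) \<A>" and A: "A \<in> sets M"
  shows "upper_variation M \<mu> A = (SUP D\<in>\<A>. ennreal (\<mu> (D \<inter> A)))"
proof (rule antisym)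
  obtain m where m: "finite_measure m" "sets m = sets M" "\<And>A. A \<in> sets M \<Longrightarrow> \<bar>\<mu> A\<bar> \<le> measure m A"
    using signed_measure_dominated[OF \<mu>] by blast
  interpret m: finite_measure m by (rule m(1))
  have sm[simp]: "space m = space M" "sets m = sets M" using m(2) sets_eq_imp_space_eq[OF m(2)] by auto
  show "upper_variation M \<mu> A \<le> (SUP D\<in>\<A>. ennreal (\<mu> (D \<inter> A)))"
    unfolding upper_variation_def
  proof (rule SUP_least, clarify)
    fix B assume B: "B \<in> sets M" "B \<subseteq> A"
    show "ennreal (\<mu> B) \<le> (SUP D\<in>\<A>. ennreal (\<mu> (D \<inter> A)))"
    proof (rule ennreal_le_epsilon)
      fix e :: real assume e: "0 < e"
      obtain D where D: "D \<in> \<A>" "measure m ((B - D) \<union> (D - B)) < e"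
        using m.algebra_approximation[of \<A> B e] alg gen B e by auto
      have Ds: "D \<in> sets M" using D(1) gen by auto
      \<comment> \<open>Intersecting with \<open>A\<close> yields an admissible competitor, and
        because \<open>B \<subseteq> A\<close> it does not enlarge the symmetric difference with
        \<open>B\<close>.\<close>
      let ?D = "D \<inter> A"
      have ds: "?D \<in> sets M" using Ds A by auto
      have "\<mu> B = \<mu> ((B - ?D) \<union> (B \<inter> ?D))" by (rule arg_cong[where f=\<mu>]) auto
      also have "\<dots> = \<mu> (B - ?D) + \<mu> (B \<inter> ?D)"
        using B ds by (intro signed_measure_Un[OF \<mu>]) auto
      finally have 1: "\<mu> B = \<mu> (B - ?D) + \<mu> (B \<inter> ?D)" .
      have "\<mu> ?D = \<mu> ((?D - B) \<union> (B \<inter> ?D))" by (rule arg_cong[where f=\<mu>]) auto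
      also have "\<dots> = \<mu> (?D - B) + \<mu> (B \<inter> ?D)"
        using B ds by (intro signed_measure_Un[OF \<mu>]) auto
      finally have 2: "\<mu> ?D = \<mu> (?D - B) + \<mu> (B \<inter> ?D)" .
      have "\<bar>\<mu> (B - ?D)\<bar> \<le> measure m (B - ?D)" "\<bar>\<mu> (?D - B)\<bar> \<le> measure m (?D - B)"
        using B ds by (auto intro: m(3))
      with 1 2 have "\<mu> B \<le> \<mu> ?D + (measure m (B - ?D) + measure m (?D - B))" by simp
      also have "measure m (B - ?D) + measure m (?D - B) = measure m ((B - ?D) \<union> (?D - B))"
        using B ds by (intro m.finite_measure_Union[symmetric]) auto
      also have "\<dots> \<le> measure m ((B - D) \<union> (D - B))"
        using B Ds by (intro m.finite_measure_mono) auto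
      finally have "\<mu> B \<le> \<mu> ?D + e" using D(2) by simp
      then have "ennreal (\<mu> B) \<le> ennreal (\<mu> ?D + e)" by (rule ennreal_leI)
      also have "\<dots> \<le> ennreal (\<mu> ?D) + ennreal e"
        using e by (cases "0 \<le> \<mu> ?D") (auto simp: ennreal_neg ennreal_leI)
      also have "\<dots> \<le> (SUP D\<in>\<A>. ennreal (\<mu> (D \<inter> A))) + ennreal e"
        using D(1) by (intro add_right_mono SUP_upper)
      finally show "ennreal (\<mu> B) \<le> (SUP D\<in>\<A>. ennreal (\<mu> (D \<inter> A))) + ennreal e" .
    qed
  qed
  show "(SUP D\<in>\<A>. ennreal (\<mu> (D \<inter> A))) \<le> upper_variation M \<mu> A"
    unfolding upper_variation_def using A gen by (intro SUP_least SUP_upper) auto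
qed

text \<open>One countable algebra serves all \<open>x\<close> at once, so the positive part is a
  countable supremum of measurable functions of \<open>x\<close>.\<close>

lemma measurable_emeasure_pos_part:
  assumes S: "signed_kernel X Y S" and Y: "standard_borel Y" and A: "A \<in> sets Y"
  shows "(\<lambda>x. emeasure (pos_part Y (S x)) A) \<in> borel_measurable X"
proof -
  obtain \<A> where \<A>: "countable \<A>" "algebra (space Y) \<A>" "sets Y = sigma_sets (space Y) \<A>"
    using standard_borel_countable_algebra[OF Y] by blast
  have \<mu>: "signed_measure Y (S x)" if "x \<in> space X" for x
    using S that by (auto simp: signed_kernel_def)
  have "emeasure (pos_part Y (S x)) A = (SUP D\<in>\<A>. ennreal (S x (D \<inter> A)))" if "x \<in> space X" for x
    unfolding jordan_decomposition_emeasure(1)[OF is_jordan_decomposition_parts[OF \<mu>[OF that]] A]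
    by (rule upper_variation_eq_SUP_algebra[OF \<mu>[OF that] \<A>(2,3) A])
  moreover have "(\<lambda>x. SUP D\<in>\<A>. ennreal (S x (D \<inter> A))) \<in> borel_measurable X"
  proof (rule borel_measurable_SUP[OF \<A>(1)])
    fix D assume "D \<in> \<A>"
    then have "D \<inter> A \<in> sets Y" using A \<A>(3) by auto
    then show "(\<lambda>x. ennreal (S x (D \<inter> A))) \<in> borel_measurable X"
      using S by (auto simp: signed_kernel_def)
  qed
  ultimately show ?thesis by (subst measurable_cong)
qed

subsection \<open>The law and the cost of rejection sampling\<close>

text \<open>Recursion on the number of remaining draws with a shifted tape, so that the first draw
  separates from an independent tail of the same law.\<close>

primrec first_accepted :: "('s \<times> 'y \<Rightarrow> bool) \<Rightarrow> 'y \<Rightarrow> nat \<Rightarrow> (nat \<Rightarrow> 's \<times> 'y) \<Rightarrow> 'y" where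
  "first_accepted acc y0 0 \<omega> = y0"
| "first_accepted acc y0 (Suc n) \<omega> =
     (if acc (\<omega> 0) then snd (\<omega> 0) else first_accepted acc y0 n (\<lambda>t. \<omega> (Suc t)))"

text \<open>Stated for an arbitrary unset state so that the induction can follow the loop:
  \<open>n\<close> counts the iterations left, and the counter gives the position on the tape.
  Induction on \<open>n\<close> takes the place of a termination argument.\<close>

lemma rk_while_val:
  assumes "\<not> is_set s" "iter s + n = N + 1"
  shows "val (while (\<lambda>s. \<not> (is_set s \<or> iter s \<ge> N + 1)) (rk_step c Tsamp Teval g M \<omega>) s) =
    first_accepted (\<lambda>w. fst w \<le> 1 / M * g (snd w)) (val s) n (\<lambda>t. \<omega> (iter s + t))"
  using assms
proof (induction n arbitrary: s)
  case 0
  then show ?case by (subst while_unfold) simp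
next
  case (Suc n)
  let ?s = "rk_step c Tsamp Teval g M \<omega> s"
  let ?acc = "fst (\<omega> (iter s)) \<le> 1 / M * g (snd (\<omega> (iter s)))"
  have s: "iter ?s = Suc (iter s)" "val ?s = (if ?acc then snd (\<omega> (iter s)) else val s)" "is_set ?s = ?acc"
    using Suc.prems by (simp_all add: rk_step_def Let_def)
  have unfold: "while (\<lambda>s. \<not> (is_set s \<or> iter s \<ge> N + 1)) (rk_step c Tsamp Teval g M \<omega>) s =
    while (\<lambda>s. \<not> (is_set s \<or> iter s \<ge> N + 1)) (rk_step c Tsamp Teval g M \<omega>) ?s"
    using Suc.prems by (subst while_unfold) simp
  show ?case
  proof (cases "is_set ?s")
    case True
    then have "while (\<lambda>s. \<not> (is_set s \<or> iter s \<ge> N + 1)) (rk_step c Tsamp Teval g M \<omega>) ?s = ?s"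
      by (subst while_unfold) simp
    then show ?thesis using True s unfolding unfold by simp
  next
    case False
    then show ?thesis using Suc.IH[of ?s] Suc.prems s unfolding unfold by simp
  qed
qed

text \<open>After an early acceptance the iterations left over are never paid for; nonnegativity of
  the cost per iteration keeps the bound valid then.\<close>

lemma rk_while_cost:
  assumes "\<not> is_set s" "iter s + n = N + 1" "0 \<le> Tsamp + Teval + c"
  shows "cost (while (\<lambda>s. \<not> (is_set s \<or> iter s \<ge> N + 1)) (rk_step c Tsamp Teval g M \<omega>) s)
    \<le> cost s + real n * (Tsamp + Teval + c)"
  using assms
proof (induction n arbitrary: s)
  case 0
  then show ?case by (subst while_unfold) simp
next
  case (Suc n)
  let ?s = "rk_step c Tsamp Teval g M \<omega> s"
  have cost: "cost ?s = cost s + (Tsamp + Teval + c)" by (simp add: rk_step_def Let_def)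
  have unfold: "while (\<lambda>s. \<not> (is_set s \<or> iter s \<ge> N + 1)) (rk_step c Tsamp Teval g M \<omega>) s =
    while (\<lambda>s. \<not> (is_set s \<or> iter s \<ge> N + 1)) (rk_step c Tsamp Teval g M \<omega>) ?s"
    using Suc.prems by (subst while_unfold) simp
  show ?case
  proof (cases "is_set ?s")
    case True
    then have "while (\<lambda>s. \<not> (is_set s \<or> iter s \<ge> N + 1)) (rk_step c Tsamp Teval g M \<omega>) ?s = ?s"
      by (subst while_unfold) simp
    moreover have "0 \<le> real n * (Tsamp + Teval + c)" using Suc.prems(3) by simp
    ultimately show ?thesis using Suc.prems(3)
      unfolding unfold by (simp add: cost algebra_simps)
  next
    case False
    then have "cost (while (\<lambda>s. \<not> (is_set s \<or> iter s \<ge> N + 1)) (rk_step c Tsamp Teval g M \<omega>) ?s)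
        \<le> cost ?s + real n * (Tsamp + Teval + c)"
      using Suc.prems by (intro Suc.IH) (auto simp: rk_step_def Let_def)
    then show ?thesis unfolding unfold by (simp add: cost algebra_simps)
  qed
qed

lemma rk_output_eq:
  "rk_output g N M y0 = first_accepted (\<lambda>w. fst w \<le> 1 / M * g (snd w)) y0 (Suc N)"
proof
  fix \<omega>
  show "rk_output g N M y0 \<omega> = first_accepted (\<lambda>w. fst w \<le> 1 / M * g (snd w)) y0 (Suc N) \<omega>"
    unfolding rk_output_def rk_run_def
    by (subst rk_while_val[where n="Suc N"]) (simp_all add: rk_init_def del: first_accepted.simps)
qed

lemma rk_time_le:
  assumes "0 \<le> Tsamp + Teval + c"
  shows "rk_time c Tsamp Teval g N M y0 \<omega> \<le> c + (real N + 1) * (Tsamp + Teval + c)"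
  unfolding rk_time_def rk_run_def
  using rk_while_cost[of "rk_init c y0" "N + 1" N Tsamp Teval c g M \<omega>] assms
  by (simp add: rk_init_def algebra_simps)

text \<open>Conditioning on the first entry: by \<open>PiM_iter\<close> the tape is distributed as a
  draw from \<open>Q\<close> put in front of an independent tape, which gives a linear recurrence in
  \<open>n\<close>.\<close>

lemma first_accepted_law:
  assumes Q: "prob_space Q" and acc[measurable]: "Measurable.pred Q acc"
    and snd[measurable]: "snd \<in> Q \<rightarrow>\<^sub>M Y" and y0[measurable]: "y0 \<in> space Y"
  shows "first_accepted acc y0 n \<in> PiM UNIV (\<lambda>_. Q) \<rightarrow>\<^sub>M Y" (is "?m n")
    and "C \<in> sets Y \<Longrightarrow> measure Q {w\<in>space Q. acc w} > 0 \<Longrightarrow>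
      measure (distr (PiM UNIV (\<lambda>_. Q)) Y (first_accepted acc y0 n)) C =
        (1 - (1 - measure Q {w\<in>space Q. acc w}) ^ n) *
          (measure Q {w\<in>space Q. acc w \<and> snd w \<in> C} / measure Q {w\<in>space Q. acc w}) +
        (1 - measure Q {w\<in>space Q. acc w}) ^ n * indicator C y0"
proof -
  interpret Q: prob_space Q by fact
  interpret sequence_space Q by standard
  show m[measurable]: "first_accepted acc y0 n \<in> S \<rightarrow>\<^sub>M Y" for n
  proof (induction n)
    case (Suc n)
    have "(\<lambda>\<omega> t. \<omega> (Suc t)) \<in> S \<rightarrow>\<^sub>M S"
      by (rule measurable_PiM_single') (auto simp: space_PiM PiE_iff)
    then have [measurable]: "(\<lambda>\<omega>. first_accepted acc y0 n (\<lambda>t. \<omega> (Suc t))) \<in> S \<rightarrow>\<^sub>M Y"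
      using Suc by (rule measurable_compose)
    show ?case by simp
  qed simp
  assume C[measurable]: "C \<in> sets Y" and pos: "measure Q {w\<in>space Q. acc w} > 0"
  let ?a = "measure Q {w\<in>space Q. acc w}" and ?b = "measure Q {w\<in>space Q. acc w \<and> snd w \<in> C}"
  let ?E = "\<lambda>n. {\<omega>\<in>space S. first_accepted acc y0 n \<omega> \<in> C}"
  have "measure S (?E n) = (1 - (1 - ?a) ^ n) * (?b / ?a) + (1 - ?a) ^ n * indicator C y0"
  proof (induction n)
    case 0
    show ?case using P.prob_space by (auto simp: indicator_def)
  next
    case (Suc n)
    have rej: "measure Q {w\<in>space Q. \<not> acc w} = 1 - ?a"
      by (rule Q.prob_neg) measurable
    have case_nat[measurable]: "(\<lambda>(s, \<omega>). case_nat s \<omega>) \<in> Q \<Otimes>\<^sub>M S \<rightarrow>\<^sub>M S" by measurable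
    have "emeasure S (?E (Suc n)) = emeasure (distr (Q \<Otimes>\<^sub>M S) S (\<lambda>(s, \<omega>). case_nat s \<omega>)) (?E (Suc n))"
      by (simp only: PiM_iter)
    also have "\<dots> = emeasure (Q \<Otimes>\<^sub>M S) ((\<lambda>(s, \<omega>). case_nat s \<omega>) -` ?E (Suc n) \<inter> space (Q \<Otimes>\<^sub>M S))"
      by (rule emeasure_distr) measurable
    \<comment> \<open>Acceptance leaves the tail free, rejection passes the event on to it; both
      pieces are rectangles, so the product measure factors.\<close>
    also have "(\<lambda>(s, \<omega>). case_nat s \<omega>) -` ?E (Suc n) \<inter> space (Q \<Otimes>\<^sub>M S) =
      {w\<in>space Q. acc w \<and> snd w \<in> C} \<times> space S \<union> {w\<in>space Q. \<not> acc w} \<times> ?E n"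
      by (auto simp: space_pair_measure space_PiM PiE_iff split: nat.split)
    also have "emeasure (Q \<Otimes>\<^sub>M S) \<dots> = emeasure (Q \<Otimes>\<^sub>M S) ({w\<in>space Q. acc w \<and> snd w \<in> C} \<times> space S) +
      emeasure (Q \<Otimes>\<^sub>M S) ({w\<in>space Q. \<not> acc w} \<times> ?E n)"
      by (intro plus_emeasure[symmetric]) (auto, measurable)
    also have "\<dots> = emeasure Q {w\<in>space Q. acc w \<and> snd w \<in> C} * emeasure S (space S) +
       emeasure Q {w\<in>space Q. \<not> acc w} * emeasure S (?E n)"
      by (intro arg_cong2[where f="(+)"] P.emeasure_pair_measure_Times) measurable
    also have "\<dots> = ennreal (?b + (1 - ?a) * measure S (?E n))"
      unfolding rej[symmetric] P.emeasure_space_1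
      by (simp add: Q.emeasure_eq_measure P.emeasure_eq_measure ennreal_mult)
    finally have eq: "ennreal (measure S (?E (Suc n))) = ennreal (?b + (1 - ?a) * measure S (?E n))"
      unfolding P.emeasure_eq_measure .
    have "0 \<le> ?b + (1 - ?a) * measure S (?E n)"
      unfolding rej[symmetric] by simp
    with eq have "measure S (?E (Suc n)) = ?b + (1 - ?a) * measure S (?E n)"
      by (simp only: ennreal_inj[OF measure_nonneg])
    \<comment> \<open>The recurrence has the fixed point \<open>?b / ?a\<close>, and the distance to
      it shrinks by the factor \<open>1 - ?a\<close> at each step.\<close>
    then show ?case using pos unfolding Suc.IH by (simp add: field_simps)
  qed
  then show "measure (distr S Y (first_accepted acc y0 n)) C =
     (1 - (1 - ?a) ^ n) * (?b / ?a) + (1 - ?a) ^ n * indicator C y0"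
    by (simp add: measure_distr vimage_def Int_def conj_commute)
qed

section \<open>Acceptance probability of a single iteration\<close>

lemma emeasure_uniform_Iic:
  assumes "0 \<le> t" "t \<le> (1::real)"
  shows "emeasure (uniform_measure lborel {0..1}) {..t} = ennreal t"
proof -
  have "{0..1} \<inter> {..t} = {0..t}" using assms by auto
  then show ?thesis using assms divide_ennreal[of t 1] by simp
qed

text \<open>By Fubini a proposal \<open>y\<close> is accepted with probability
  \<open>f y / M\<close>, and integrating \<open>f\<close> over \<open>C\<close> against the
  proposal law returns \<open>\<nu> C\<close>.\<close>

lemma rk_acceptance_probability:
  assumes P: "prob_space P" and sP: "sets P = sets Y" and f: "is_RN_deriv P \<nu> f"
    and M: "0 < M" "\<forall>y\<in>space Y. f y \<le> M" and C: "C \<in> sets Y"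
  defines "Q \<equiv> uniform_measure lborel {0..1} \<Otimes>\<^sub>M P"
  shows "prob_space Q" "Measurable.pred Q (\<lambda>w. fst w \<le> 1 / M * f (snd w))"
    and "emeasure Q {w\<in>space Q. fst w \<le> 1 / M * f (snd w) \<and> snd w \<in> C} = emeasure \<nu> C / ennreal M"
proof -
  have sp[simp]: "space P = space Y" using sP by (rule sets_eq_imp_space_eq)
  have f_meas[measurable]: "f \<in> borel_measurable P" and f_nn: "\<And>y. y \<in> space Y \<Longrightarrow> 0 \<le> f y"
    and \<nu>: "density P (\<lambda>y. ennreal (f y)) = \<nu>"
    using f unfolding is_RN_deriv_def by auto
  interpret P: prob_space P by fact
  interpret U: prob_space "uniform_measure lborel {0..1::real}"
    by (rule prob_space_uniform_measure) auto
  interpret UP: pair_prob_space "uniform_measure lborel {0..1::real}" P ..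
  show "prob_space Q" unfolding Q_def by (rule UP.prob_space_axioms)
  show acc[measurable]: "Measurable.pred Q (\<lambda>w. fst w \<le> 1 / M * f (snd w))"
    unfolding Q_def by measurable
  have C'[measurable]: "C \<in> sets P" using C sP by simp
  let ?A = "{w\<in>space Q. fst w \<le> 1 / M * f (snd w) \<and> snd w \<in> C}"
  have "?A \<in> sets Q" unfolding Q_def by measurable
  then have "emeasure Q ?A = (\<integral>\<^sup>+y. emeasure (uniform_measure lborel {0..1}) ((\<lambda>u. (u, y)) -` ?A) \<partial>P)"
    unfolding Q_def by (rule UP.emeasure_pair_measure_alt2)
  also have "\<dots> = (\<integral>\<^sup>+y. ennreal (f y) * indicator C y / ennreal M \<partial>P)"
  proof (rule nn_integral_cong)
    fix y assume y: "y \<in> space P"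
    \<comment> \<open>The section is a full half-line, as the uniform law lives on all reals;
      \<open>0 \<le> f y \<le> M\<close> makes its mass exactly \<open>f y / M\<close>.\<close>
    have "(\<lambda>u. (u, y)) -` ?A = (if y \<in> C then {..f y / M} else {})"
      using y by (auto simp: Q_def space_pair_measure)
    then show "emeasure (uniform_measure lborel {0..1}) ((\<lambda>u. (u, y)) -` ?A)
        = ennreal (f y) * indicator C y / ennreal M"
      using y f_nn[of y] M by (simp add: emeasure_uniform_Iic divide_ennreal del: emeasure_uniform_measure)
  qed
  also have "\<dots> = (\<integral>\<^sup>+y. ennreal (f y) * indicator C y \<partial>P) / ennreal M"
    by (rule nn_integral_divide) measurable
  also have "(\<integral>\<^sup>+y. ennreal (f y) * indicator C y \<partial>P) = emeasure \<nu> C"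
    unfolding \<nu>[symmetric] by (rule emeasure_density[symmetric]) measurable
  finally show "emeasure Q ?A = emeasure \<nu> C / ennreal M" .
qed

text \<open>The quotient of the total mass by \<open>M\<close> is the overall acceptance
  probability, hence at most 1; later this keeps the rejection weight between 0 and 1. Conditionally
  on acceptance, \<open>M\<close> cancels.\<close>

lemma rk_law_eq:
  assumes P: "prob_space (P x)" and sP: "sets (P x) = sets Y" and f: "is_RN_deriv (P x) \<nu> (r x)"
    and \<nu>: "finite_measure \<nu>" "0 < measure \<nu> (space Y)"
    and M: "0 < M" "\<forall>y\<in>space Y. r x y \<le> M" and y0: "y0 \<in> space Y"
  shows "prob_space (rk_law Y P r N M y0 x)" "measure \<nu> (space Y) \<le> M"
    and "C \<in> sets Y \<Longrightarrow> measure (rk_law Y P r N M y0 x) C =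
      (1 - (1 - measure \<nu> (space Y) / M) ^ Suc N) * (measure \<nu> C / measure \<nu> (space Y)) +
      (1 - measure \<nu> (space Y) / M) ^ Suc N * indicator C y0"
proof -
  define Q where "Q = uniform_measure lborel {0..1::real} \<Otimes>\<^sub>M P x"
  let ?acc = "\<lambda>w. fst w \<le> 1 / M * r x (snd w)"
  interpret \<nu>: finite_measure \<nu> by fact
  note Q = rk_acceptance_probability[OF P sP f M, folded Q_def]
  interpret Q: prob_space Q using Q(1)[of "{}"] by simp
  have sp: "space (P x) = space Y" using sP by (rule sets_eq_imp_space_eq)
  have acc: "measure Q {w\<in>space Q. ?acc w \<and> snd w \<in> C} = measure \<nu> C / M" if "C \<in> sets Y" for C
    using Q(3)[OF that] M(1)
    by (simp add: Q.emeasure_eq_measure \<nu>.emeasure_eq_measure divide_ennreal)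
  have "{w\<in>space Q. ?acc w} = {w\<in>space Q. ?acc w \<and> snd w \<in> space Y}"
    by (auto simp: Q_def space_pair_measure sp)
  with acc[of "space Y"] have acc1: "measure Q {w\<in>space Q. ?acc w} = measure \<nu> (space Y) / M" by simp
  have "measure \<nu> (space Y) / M \<le> 1"
    unfolding acc1[symmetric] by (rule Q.prob_le_1)
  then show "measure \<nu> (space Y) \<le> M"
    using M(1) by (simp add: field_simps)
  have snd: "snd \<in> Q \<rightarrow>\<^sub>M Y" unfolding Q_def using sP by (simp cong: measurable_cong_sets)
  note law = first_accepted_law[OF Q.prob_space_axioms Q(2)[of "{}"] snd y0]
  have rk: "rk_law Y P r N M y0 x = distr (PiM UNIV (\<lambda>_. Q)) Y (first_accepted ?acc y0 (Suc N))"
    unfolding rk_law_def rk_tape_def rk_output_eq Q_def ..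
  have "prob_space (PiM UNIV (\<lambda>_::nat. Q))"
    by (intro prob_space_PiM Q.prob_space_axioms)
  then show "prob_space (rk_law Y P r N M y0 x)"
    unfolding rk by (rule prob_space.prob_space_distr) (rule law(1), simp)
  show "measure (rk_law Y P r N M y0 x) C =
      (1 - (1 - measure \<nu> (space Y) / M) ^ Suc N) * (measure \<nu> C / measure \<nu> (space Y)) +
      (1 - measure \<nu> (space Y) / M) ^ Suc N * indicator C y0" if "C \<in> sets Y"
    using law(2)[OF _ that, of "Suc N"] \<nu>(2) M(1) unfolding rk acc1 acc[OF that] by simp
qed

subsection \<open>Error bounds\<close>

text \<open>Termwise over each partition, so no additivity of the three set functions
  enters.\<close>

lemma variation_triangle:
  "variation M (\<lambda>A. f A - g A) \<Omega> \<le> variation M (\<lambda>A. f A - h A) \<Omega> + variation M (\<lambda>A. h A - g A) \<Omega>"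
  unfolding variation_def[of _ "\<lambda>A. f A - g A"]
proof (rule SUP_least)
  fix \<A> assume \<A>: "\<A> \<in> {\<A>. finite \<A> \<and> \<A> \<subseteq> sets M \<and> disjoint \<A> \<and> \<Union>\<A> = \<Omega>}"
  have "(\<Sum>B\<in>\<A>. \<bar>f B - g B\<bar>) \<le> (\<Sum>B\<in>\<A>. \<bar>f B - h B\<bar>) + (\<Sum>B\<in>\<A>. \<bar>h B - g B\<bar>)"
    unfolding sum.distrib[symmetric] by (rule sum_mono) linarith
  then have "ennreal (\<Sum>B\<in>\<A>. \<bar>f B - g B\<bar>)
      \<le> ennreal (\<Sum>B\<in>\<A>. \<bar>f B - h B\<bar>) + ennreal (\<Sum>B\<in>\<A>. \<bar>h B - g B\<bar>)"
    by (simp add: sum_nonneg ennreal_leI flip: ennreal_plus)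
  also have "\<dots> \<le> variation M (\<lambda>A. f A - h A) \<Omega> + variation M (\<lambda>A. h A - g A) \<Omega>"
    unfolding variation_def using \<A> by (intro add_mono SUP_upper) auto
  finally show "ennreal (\<Sum>B\<in>\<A>. \<bar>f B - g B\<bar>)
      \<le> variation M (\<lambda>A. f A - h A) \<Omega> + variation M (\<lambda>A. h A - g A) \<Omega>" .
qed

lemma variation_minus_commute:
  "variation M (\<lambda>A. f A - g A) \<Omega> = variation M (\<lambda>A. g A - f A) \<Omega>"
  unfolding variation_def by (simp add: abs_minus_commute)

lemma (in finite_measure) sum_measure_partition:
  assumes "finite \<A>" "\<A> \<subseteq> sets M" "disjoint \<A>"
  shows "(\<Sum>B\<in>\<A>. measure M B) = measure M (\<Union>\<A>)"
  using finite_measure_finite_Union[of \<A> id] assms by (simp add: disjoint_family_on_def disjoint_def)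

text \<open>Absolute value and finite sum move under the integral. Bounding each partition
  separately avoids any question of measurability of the pointwise variation in
  \<open>x\<close>.\<close>

lemma variation_integral_le:
  assumes f: "\<And>B. B \<in> sets M \<Longrightarrow> integrable \<mu> (\<lambda>x. f x B)" and h: "integrable \<mu> h"
    and eq: "\<And>B. B \<in> sets M \<Longrightarrow> \<kappa> B = (\<integral>x. f x B \<partial>\<mu>)"
    and le: "\<And>x \<A>. x \<in> space \<mu> \<Longrightarrow> finite \<A> \<Longrightarrow> \<A> \<subseteq> sets M \<Longrightarrow> disjoint \<A> \<Longrightarrow> \<Union>\<A> = \<Omega> \<Longrightarrow>
      (\<Sum>B\<in>\<A>. \<bar>f x B\<bar>) \<le> h x"
  shows "variation M \<kappa> \<Omega> \<le> ennreal (\<integral>x. h x \<partial>\<mu>)"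
  unfolding variation_def
proof (rule SUP_least, rule ennreal_leI, clarify)
  fix \<A> assume \<A>: "finite \<A>" "\<A> \<subseteq> sets M" "disjoint \<A>" "\<Omega> = \<Union>\<A>"
  have int: "integrable \<mu> (\<lambda>x. f x B)" if "B \<in> \<A>" for B using f \<A> that by auto
  have "(\<Sum>B\<in>\<A>. \<bar>\<kappa> B\<bar>) \<le> (\<Sum>B\<in>\<A>. \<integral>x. \<bar>f x B\<bar> \<partial>\<mu>)"
    using \<A> by (intro sum_mono) (auto simp: eq)
  also have "\<dots> = (\<integral>x. (\<Sum>B\<in>\<A>. \<bar>f x B\<bar>) \<partial>\<mu>)"
    using int by (subst Bochner_Integration.integral_sum) auto
  also have "\<dots> \<le> (\<integral>x. h x \<partial>\<mu>)"
    using int h le \<A> by (intro integral_mono) auto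
  finally show "(\<Sum>B\<in>\<A>. \<bar>\<kappa> B\<bar>) \<le> (\<integral>x. h x \<partial>\<mu>)" .
qed

text \<open>The power counts \<open>N + 1\<close> draws; one factor, being at most 1, is dropped to
  match the exponent \<open>N\<close> of the theorem.\<close>

lemma one_minus_power_le_exp:
  fixes a :: real
  assumes "0 \<le> a" "a \<le> 1"
  shows "(1 - a) ^ Suc n \<le> exp (- (real n * a))"
proof -
  have "(1 - a) ^ Suc n \<le> (1 - a) ^ n"
    using assms by (intro power_decreasing) auto
  also have "\<dots> \<le> exp (- a) ^ n"
    using assms exp_ge_add_one_self[of "- a"] by (intro power_mono) auto
  also have "\<dots> = exp (- (real n * a))"
    by (simp add: exp_of_nat_mult[symmetric])
  finally show ?thesis .
qed

section \<open>The normalized positive kernel\<close>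

locale pos_signed_kernel =
  fixes X :: "'x measure" and Y :: "'y measure" and S
  assumes S: "signed_kernel X Y S" and Y: "standard_borel Y"
    and pos_mass_pos: "x \<in> space X \<Longrightarrow> 0 < pos_mass Y (S x)"
begin

abbreviation "T \<equiv> normalized_pos_kernel Y S"
abbreviation "p x \<equiv> pos_mass Y (S x)"
abbreviation "q x \<equiv> neg_mass Y (S x)"

lemma jordan: "x \<in> space X \<Longrightarrow> is_jordan_decomposition Y (S x) (pos_part Y (S x)) (neg_part Y (S x))"
  using S by (intro is_jordan_decomposition_parts) (auto simp: signed_kernel_def)

lemma parts:
  assumes "x \<in> space X"
  shows "finite_measure (pos_part Y (S x))" "finite_measure (neg_part Y (S x))"
    "sets (pos_part Y (S x)) = sets Y" "sets (neg_part Y (S x)) = sets Y"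
    "B \<in> sets Y \<Longrightarrow> S x B = measure (pos_part Y (S x)) B - measure (neg_part Y (S x)) B"
  using jordan[OF assms] by (auto simp: is_jordan_decomposition_def)

lemma S_measurable[measurable]: "B \<in> sets Y \<Longrightarrow> (\<lambda>x. S x B) \<in> borel_measurable X"
  using S by (auto simp: signed_kernel_def)

lemma pos_part_measurable[measurable]:
  "B \<in> sets Y \<Longrightarrow> (\<lambda>x. measure (pos_part Y (S x)) B) \<in> borel_measurable X"
  unfolding measure_def using measurable_emeasure_pos_part[OF S Y, of B] by measurable

lemma p_measurable[measurable]: "p \<in> borel_measurable X"
  unfolding pos_mass_def by measurable

lemma T_measurable[measurable]: "B \<in> sets Y \<Longrightarrow> (\<lambda>x. T x B) \<in> borel_measurable X"
  unfolding normalized_pos_kernel_def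
  by (intro borel_measurable_divide pos_part_measurable p_measurable)

text \<open>On \<open>space X\<close> the negative mass is \<open>p x - S x (space Y)\<close>, so
  measurability of the positive part is enough.\<close>

lemma q_measurable[measurable]: "q \<in> borel_measurable X"
proof -
  have "(\<lambda>x. p x - S x (space Y)) \<in> borel_measurable X" by measurable
  also have "?this \<longleftrightarrow> ?thesis"
    by (rule measurable_cong) (simp add: parts pos_mass_def neg_mass_def)
  finally show ?thesis .
qed

lemma measure_parts_le:
  assumes "x \<in> space X" "B \<in> sets Y"
  shows "measure (pos_part Y (S x)) B \<le> p x" "measure (neg_part Y (S x)) B \<le> q x"
proof -
  have "space (pos_part Y (S x)) = space Y" "space (neg_part Y (S x)) = space Y"
    using parts(3,4)[OF assms(1)] by (auto dest: sets_eq_imp_space_eq)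
  then show "measure (pos_part Y (S x)) B \<le> p x" "measure (neg_part Y (S x)) B \<le> q x"
    using finite_measure.bounded_measure[OF parts(1)[OF assms(1)], of B]
      finite_measure.bounded_measure[OF parts(2)[OF assms(1)], of B]
    by (simp_all add: pos_mass_def neg_mass_def)
qed

lemma T_bounds: "0 \<le> T x B" "x \<in> space X \<Longrightarrow> B \<in> sets Y \<Longrightarrow> T x B \<le> 1"
  using measure_parts_le(1)[of x B] pos_mass_pos[of x]
  by (auto simp: normalized_pos_kernel_def pos_mass_def)

lemma partition_sums:
  assumes x: "x \<in> space X" and \<A>: "finite \<A>" "\<A> \<subseteq> sets Y" "disjoint \<A>" "\<Union>\<A> = space Y"
  shows "(\<Sum>B\<in>\<A>. T x B) = 1" "(\<Sum>B\<in>\<A>. measure (neg_part Y (S x)) B) = q x"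
proof -
  have "(\<Sum>B\<in>\<A>. measure (pos_part Y (S x)) B) = p x"
    using finite_measure.sum_measure_partition[OF parts(1)[OF x] \<A>(1) _ \<A>(3)] \<A> parts(3)[OF x]
    by (simp add: pos_mass_def)
  then show "(\<Sum>B\<in>\<A>. T x B) = 1"
    using pos_mass_pos[OF x] by (simp add: normalized_pos_kernel_def sum_divide_distrib[symmetric])
  show "(\<Sum>B\<in>\<A>. measure (neg_part Y (S x)) B) = q x"
    using finite_measure.sum_measure_partition[OF parts(2)[OF x] \<A>(1) _ \<A>(3)] \<A> parts(4)[OF x]
    by (simp add: neg_mass_def)
qed

text \<open>An infinite right-hand side leaves nothing to prove. A finite one makes
  \<open>S x B\<close> integrable, so that \<open>kernel_comp S U\<close> is a true average and the
  difference can be taken under the integral.\<close>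

lemma normalization_error:
  assumes U: "U \<theta> \<in> space (prob_algebra X)"
  shows "variation Y (\<lambda>B. kernel_comp S U \<theta> B - kernel_comp T U \<theta> B) (space Y)
    \<le> (\<integral>\<^sup>+x. ennreal (\<bar>p x - 1\<bar> + q x) \<partial>U \<theta>)"
proof (cases "(\<integral>\<^sup>+x. ennreal (\<bar>p x - 1\<bar> + q x) \<partial>U \<theta>) = \<infinity>")
  case False
  interpret U: prob_space "U \<theta>" using U by (simp add: space_prob_algebra)
  have sU[measurable_cong]: "sets (U \<theta>) = sets X" using U by (simp add: space_prob_algebra)
  have spU: "space (U \<theta>) = space X" using sU by (rule sets_eq_imp_space_eq)
  have q0: "0 \<le> q x" for x by (simp add: neg_mass_def)
  let ?h = "\<lambda>x. \<bar>p x - 1\<bar> + q x"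
  have h: "integrable (U \<theta>) ?h"
    using False q0 by (intro integrableI_nonneg) (auto simp: less_top)
  have Sint: "integrable (U \<theta>) (\<lambda>x. S x B)" if B: "B \<in> sets Y" for B
  proof (rule Bochner_Integration.integrable_bound)
    \<comment> \<open>The dominating function comes from \<open>\<bar>S x B\<bar> \<le> p x + q x
      \<le> 1 + \<bar>p x - 1\<bar> + q x\<close>.\<close>
    show "integrable (U \<theta>) (\<lambda>x. 1 + ?h x)" using h by auto
    show "AE x in U \<theta>. norm (S x B) \<le> norm (1 + ?h x)"
    proof (rule AE_I2)
      fix x assume "x \<in> space (U \<theta>)"
      then have x: "x \<in> space X" using spU by simp
      show "norm (S x B) \<le> norm (1 + ?h x)"
        using parts(5)[OF x B] measure_parts_le[OF x B] q0[of x]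
          measure_nonneg[of "pos_part Y (S x)" B] measure_nonneg[of "neg_part Y (S x)" B]
        unfolding real_norm_def by linarith
    qed
  qed (use B in measurable)
  have Tint: "integrable (U \<theta>) (\<lambda>x. T x B)" if B: "B \<in> sets Y" for B
    using B T_bounds spU by (intro U.integrable_const_bound[where B=1]) auto
  have "variation Y (\<lambda>B. kernel_comp S U \<theta> B - kernel_comp T U \<theta> B) (space Y)
      \<le> ennreal (\<integral>x. ?h x \<partial>U \<theta>)"
  proof (rule variation_integral_le[where f="\<lambda>x B. S x B - T x B"])
    fix x \<A> assume x: "x \<in> space (U \<theta>)"
      and \<A>: "finite \<A>" "\<A> \<subseteq> sets Y" "disjoint \<A>" "\<Union>\<A> = space Y"
    have x: "x \<in> space X" using x spU by simp
    have "(\<Sum>B\<in>\<A>. \<bar>S x B - T x B\<bar>) \<le> (\<Sum>B\<in>\<A>. \<bar>p x - 1\<bar> * T x B + measure (neg_part Y (S x)) B)"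
    proof (rule sum_mono)
      fix B assume "B \<in> \<A>"
      then have "S x B = p x * T x B - measure (neg_part Y (S x)) B"
        using parts(5)[OF x, of B] \<A>(2) pos_mass_pos[OF x] by (auto simp: normalized_pos_kernel_def)
      then have "\<bar>S x B - T x B\<bar> = \<bar>(p x - 1) * T x B - measure (neg_part Y (S x)) B\<bar>"
        by (simp add: algebra_simps)
      also have "\<dots> \<le> \<bar>(p x - 1) * T x B\<bar> + \<bar>measure (neg_part Y (S x)) B\<bar>"
        by (rule abs_triangle_ineq4)
      finally show "\<bar>S x B - T x B\<bar> \<le> \<bar>p x - 1\<bar> * T x B + measure (neg_part Y (S x)) B"
        by (simp add: abs_mult T_bounds)
    qed
    also have "\<dots> = ?h x"
      using partition_sums[OF x \<A>] by (simp add: sum.distrib flip: sum_distrib_left)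
    finally show "(\<Sum>B\<in>\<A>. \<bar>S x B - T x B\<bar>) \<le> ?h x" .
  qed (use Sint Tint h in \<open>auto simp: kernel_comp_def\<close>)
  also have "\<dots> = (\<integral>\<^sup>+x. ennreal (?h x) \<partial>U \<theta>)"
    using h q0 by (intro nn_integral_eq_integral[symmetric]) auto
  finally show ?thesis .
qed simp

text \<open>For each input the output law differs from \<open>T x\<close> by \<open>?w x\<close>
  times the point mass at \<open>y0\<close> minus \<open>T x\<close>; this difference is integrated
  over the input.\<close>

lemma rk_error:
  assumes U: "U \<theta> \<in> space (prob_algebra X)"
    and P: "\<And>x. x \<in> space X \<Longrightarrow> P x \<in> space (prob_algebra Y)"
    and r: "\<And>x. x \<in> space X \<Longrightarrow> is_RN_deriv (P x) (pos_part Y (S x)) (r x)"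
    and M: "0 < M" "\<And>x. x \<in> space X \<Longrightarrow> \<forall>y\<in>space Y. r x y \<le> M" and y0: "y0 \<in> space Y"
  shows "variation Y (\<lambda>B. measure (rk_law_random_input Y P r N M y0 (U \<theta>)) B - kernel_comp T U \<theta> B) (space Y)
    \<le> ennreal (2 * exp (- (real N / M * (INF x\<in>space X. p x))))"
proof -
  interpret U: prob_space "U \<theta>" using U by (simp add: space_prob_algebra)
  have sU[measurable_cong]: "sets (U \<theta>) = sets X" using U by (simp add: space_prob_algebra)
  have spU: "space (U \<theta>) = space X" using sU by (rule sets_eq_imp_space_eq)
  let ?w = "\<lambda>x. (1 - p x / M) ^ Suc N"
  let ?K = "exp (- (real N / M * (INF x\<in>space X. p x)))"
  have law: "prob_space (rk_law Y P r N M y0 x)" "p x \<le> M"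
    "C \<in> sets Y \<Longrightarrow> measure (rk_law Y P r N M y0 x) C = (1 - ?w x) * T x C + ?w x * indicator C y0"
    if x: "x \<in> space X" for x C
  proof -
    have P': "prob_space (P x)" "sets (P x) = sets Y" using P[OF x] by (auto simp: space_prob_algebra)
    note l = rk_law_eq[of P x Y "pos_part Y (S x)" r M y0, OF P' r[OF x] parts(1)[OF x] _ M(1) M(2)[OF x] y0,
        folded pos_mass_def, OF pos_mass_pos[OF x]]
    show "prob_space (rk_law Y P r N M y0 x)" "p x \<le> M" by (fact l(1), fact l(2))
    show "measure (rk_law Y P r N M y0 x) C = (1 - ?w x) * T x C + ?w x * indicator C y0" if "C \<in> sets Y"
      using l(3)[OF that] by (simp add: normalized_pos_kernel_def)
  qed
  have w: "0 \<le> ?w x" "?w x \<le> ?K" "?w x \<le> 1" if x: "x \<in> space X" for x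
  proof -
    have a: "0 \<le> p x / M" "p x / M \<le> 1" using law(2)[OF x] pos_mass_pos[OF x] M(1) by auto
    then show "0 \<le> ?w x" by simp
    show "?w x \<le> 1" using a by (intro power_le_one) auto
    \<comment> \<open>A real infimum is a lower bound only for a family bounded below; the masses
      are bounded below by 0.\<close>
    have "(INF x\<in>space X. p x) \<le> p x"
      using x by (intro cINF_lower bdd_belowI2[where m=0]) (auto simp: pos_mass_def)
    then have "real N / M * (INF x\<in>space X. p x) \<le> real N / M * p x"
      using M(1) by (intro mult_left_mono) auto
    then have "exp (- (real N * (p x / M))) \<le> ?K" by simp
    with one_minus_power_le_exp[OF a, of N] show "?w x \<le> ?K" by (rule order_trans)
  qed
  have wm[measurable]: "?w \<in> borel_measurable X" by measurable
  \<comment> \<open>Nothing is assumed about \<open>P x\<close> and \<open>r x\<close> as functions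
    of \<open>x\<close>; measurability is taken from the closed form, in which only \<open>p\<close>
    and \<open>T\<close> remain.\<close>
  have emeas: "(\<lambda>x. emeasure (rk_law Y P r N M y0 x) C) \<in> borel_measurable X" if C: "C \<in> sets Y" for C
  proof -
    have "(\<lambda>x. ennreal ((1 - ?w x) * T x C + ?w x * indicator C y0)) \<in> borel_measurable X"
      using C by measurable
    also have "?this \<longleftrightarrow> ?thesis"
    proof (rule measurable_cong)
      fix x assume x: "x \<in> space X"
      interpret prob_space "rk_law Y P r N M y0 x" by (rule law(1)[OF x])
      show "ennreal ((1 - ?w x) * T x C + ?w x * indicator C y0) = emeasure (rk_law Y P r N M y0 x) C"
        using law(3)[OF x C] by (simp add: emeasure_eq_measure)
    qed
    finally show ?thesis .
  qed
  have rk: "rk_law Y P r N M y0 \<in> U \<theta> \<rightarrow>\<^sub>M subprob_algebra Y"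
  proof (rule measurable_subprob_algebra)
    show "subprob_space (rk_law Y P r N M y0 x)" if "x \<in> space (U \<theta>)" for x
      using law(1)[of x] that spU by (simp add: prob_space_imp_subprob_space)
  qed (use emeas sU in \<open>auto simp: rk_law_def cong: measurable_cong_sets\<close>)
  have int: "integrable (U \<theta>) (\<lambda>x. T x C)" "integrable (U \<theta>) (\<lambda>x. ?w x * (indicator C y0 - T x C))"
    if C: "C \<in> sets Y" for C
  proof -
    show "integrable (U \<theta>) (\<lambda>x. T x C)"
      using C T_bounds spU by (intro U.integrable_const_bound[where B=1]) auto
    show "integrable (U \<theta>) (\<lambda>x. ?w x * (indicator C y0 - T x C))"
    proof (rule U.integrable_const_bound[where B=1])
      show "AE x in U \<theta>. norm (?w x * (indicator C y0 - T x C)) \<le> 1"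
      proof (rule AE_I2)
        fix x assume "x \<in> space (U \<theta>)"
        then have x: "x \<in> space X" using spU by simp
        have "\<bar>indicator C y0 - T x C\<bar> \<le> 1"
          using T_bounds[of x C] x C by (auto simp: indicator_def)
        then show "norm (?w x * (indicator C y0 - T x C)) \<le> 1"
          using w[OF x] by (simp add: abs_mult del: power_Suc) (intro mult_le_one; simp)
      qed
    qed (use C in measurable)
  qed
  have "variation Y (\<lambda>B. measure (rk_law_random_input Y P r N M y0 (U \<theta>)) B - kernel_comp T U \<theta> B) (space Y)
      \<le> ennreal (\<integral>x. 2 * ?K \<partial>U \<theta>)"
  proof (rule variation_integral_le[where f="\<lambda>x B. ?w x * (indicator B y0 - T x B)"])
    fix B assume B: "B \<in> sets Y"
    show "integrable (U \<theta>) (\<lambda>x. ?w x * (indicator B y0 - T x B))" by (rule int(2)[OF B])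
    have "measure (rk_law_random_input Y P r N M y0 (U \<theta>)) B = (\<integral>x. measure (rk_law Y P r N M y0 x) B \<partial>U \<theta>)"
      unfolding rk_law_random_input_def by (rule U.measure_bind[OF rk B])
    also have "\<dots> = (\<integral>x. T x B + ?w x * (indicator B y0 - T x B) \<partial>U \<theta>)"
      using law(3)[OF _ B] spU
      by (intro Bochner_Integration.integral_cong) (auto simp: algebra_simps simp del: power_Suc)
    also have "\<dots> = kernel_comp T U \<theta> B + (\<integral>x. ?w x * (indicator B y0 - T x B) \<partial>U \<theta>)"
      unfolding kernel_comp_def by (rule Bochner_Integration.integral_add[OF int[OF B]])
    finally show "measure (rk_law_random_input Y P r N M y0 (U \<theta>)) B - kernel_comp T U \<theta> B =
      (\<integral>x. ?w x * (indicator B y0 - T x B) \<partial>U \<theta>)" by simp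
  next
    fix x \<A> assume x: "x \<in> space (U \<theta>)"
      and \<A>: "finite \<A>" "\<A> \<subseteq> sets Y" "disjoint \<A>" "\<Union>\<A> = space Y"
    have x: "x \<in> space X" using x spU by simp
    interpret \<delta>: prob_space "return Y y0" by (rule prob_space_return[OF y0])
    have "(\<Sum>B\<in>\<A>. indicator B y0) = (\<Sum>B\<in>\<A>. measure (return Y y0) B)"
      using \<A>(2) by (intro sum.cong) (auto simp: measure_return)
    also have "\<dots> = 1"
      using \<delta>.sum_measure_partition[of \<A>] \<A> \<delta>.prob_space by simp
    finally have \<delta>: "(\<Sum>B\<in>\<A>. indicator B y0) = (1::real)" .
    have "(\<Sum>B\<in>\<A>. \<bar>?w x * (indicator B y0 - T x B)\<bar>) \<le> (\<Sum>B\<in>\<A>. ?w x * (indicator B y0 + T x B))"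
    proof (rule sum_mono)
      fix B
      have "\<bar>indicator B y0 - T x B\<bar> \<le> indicator B y0 + T x B"
        using T_bounds(1)[of x B] by (auto simp: indicator_def)
      then show "\<bar>?w x * (indicator B y0 - T x B)\<bar> \<le> ?w x * (indicator B y0 + T x B)"
        unfolding abs_mult abs_of_nonneg[OF w(1)[OF x]] using w(1)[OF x] by (rule mult_left_mono)
    qed
    \<comment> \<open>Origin of the factor 2: over a partition the point mass and \<open>T x\<close>
      each sum to 1.\<close>
    also have "\<dots> = 2 * ?w x"
      using partition_sums(1)[OF x \<A>] \<delta> by (simp add: sum.distrib del: power_Suc flip: sum_distrib_left)
    also have "\<dots> \<le> 2 * ?K" using w(2)[OF x] by simp
    finally show "(\<Sum>B\<in>\<A>. \<bar>?w x * (indicator B y0 - T x B)\<bar>) \<le> 2 * ?K" .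
  qed simp
  then show ?thesis by (simp add: U.prob_space)
qed

end

text \<open>From \<open>N + 1 \<le> 2 * N\<close> comes the 2. The bookkeeping costs amount to at
  most \<open>c * (2 * N + 1)\<close>, and \<open>Teval + Tsamp \<ge> 2\<close> absorbs them into
  \<open>2 * c\<close> times the main term.\<close>

lemma rk_time_bound:
  assumes "0 \<le> c" "1 \<le> Tsamp" "1 \<le> Teval" "1 \<le> N"
  shows "rk_time c Tsamp Teval g N M y0 \<omega> \<le> (2 + 2 * c) * (real N * (Teval + Tsamp))"
proof -
  let ?T = "Teval + Tsamp"
  have N: "real N + 1 \<le> 2 * real N" using assms by simp
  have "rk_time c Tsamp Teval g N M y0 \<omega> \<le> c + (real N + 1) * (?T + c)"
    using rk_time_le[of Tsamp Teval c g N M y0 \<omega>] assms by (simp add: add.commute)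
  also have "\<dots> \<le> c + (2 * real N) * (?T + c)"
    using N assms by (intro add_left_mono mult_right_mono) auto
  also have "\<dots> = 2 * (real N * ?T) + c * (2 * real N + 1)"
    by (simp add: algebra_simps)
  also have "\<dots> \<le> 2 * (real N * ?T) + c * (2 * (real N * ?T))"
  proof (intro add_left_mono mult_left_mono)
    have "real N * 2 \<le> real N * ?T" using assms by (intro mult_left_mono) auto
    then show "2 * real N + 1 \<le> 2 * (real N * ?T)" using assms by linarith
  qed fact
  finally show ?thesis by (simp add: algebra_simps)
qed

section \<open>Assembly of the error terms\<close>

context pos_signed_kernel
begin

lemma total_error:
  assumes U: "U \<in> \<Theta> \<rightarrow>\<^sub>M prob_algebra X"
    and P: "\<forall>x\<in>space X. P x \<in> space (prob_algebra Y)"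
    and r: "\<forall>x\<in>space X. is_RN_deriv (P x) (pos_part Y (S x)) (r x)"
    and M: "0 < M" "\<forall>x\<in>space X. \<forall>y\<in>space Y. r x y \<le> M" and y0: "y0 \<in> space Y"
  shows "(SUP \<theta>\<in>space \<Theta>. tv_dist Y (rk_law_random_input Y P r N M y0 (U \<theta>)) (V \<theta>))
    \<le> ennreal (2 * exp (- (real N / M * (INF x\<in>space X. p x))))
      + signed_deficiency \<Theta> Y U V S + kernel_dist \<Theta> Y (kernel_comp S U) (kernel_comp T U)"
proof (rule SUP_least)
  fix \<theta> assume \<theta>: "\<theta> \<in> space \<Theta>"
  let ?L = "\<lambda>B. measure (rk_law_random_input Y P r N M y0 (U \<theta>)) B"
  let ?V = "\<lambda>B. measure (V \<theta>) B" and ?SU = "kernel_comp S U \<theta>" and ?TU = "kernel_comp T U \<theta>"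
  let ?K = "exp (- (real N / M * (INF x\<in>space X. p x)))"
  let ?var = "\<lambda>f g. variation Y (\<lambda>B. f B - g B) (space Y)"
  have U\<theta>: "U \<theta> \<in> space (prob_algebra X)"
    using U \<theta> by (rule measurable_space)
  have "?var ?L ?V \<le> ?var ?L ?TU + ?var ?TU ?V"
    by (rule variation_triangle)
  also have "\<dots> \<le> ?var ?L ?TU + (?var ?TU ?SU + ?var ?SU ?V)"
    by (intro add_left_mono variation_triangle)
  \<comment> \<open>Two differences are reversed to the orientation used in
    \<open>kernel_dist\<close> and \<open>signed_deficiency\<close>.\<close>
  also have "\<dots> = ?var ?L ?TU + (?var ?SU ?TU + ?var ?V ?SU)"
    by (simp only: variation_minus_commute[of Y ?TU ?SU] variation_minus_commute[of Y ?SU ?V])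
  finally have "?var ?L ?V / 2 \<le> (?var ?L ?TU + (?var ?SU ?TU + ?var ?V ?SU)) / 2"
    by (rule divide_right_mono_ennreal)
  also have "\<dots> = ?var ?L ?TU / 2 + ?var ?V ?SU / 2 + ?var ?SU ?TU / 2"
    by (simp add: add_divide_distrib_ennreal ac_simps)
  also have "\<dots> \<le> ennreal (2 * ?K) + signed_deficiency \<Theta> Y U V S
      + kernel_dist \<Theta> Y (kernel_comp S U) (kernel_comp T U)"
  proof (intro add_mono)
    \<comment> \<open>\<open>rk_error\<close> bounds the variation before halving, so the half is at
      most \<open>?K\<close>; the stated bound keeps \<open>2 * ?K\<close>.\<close>
    have "?var ?L ?TU / 2 \<le> ennreal (2 * ?K) / 2"
      by (intro divide_right_mono_ennreal rk_error) (use U\<theta> P r M y0 in auto)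
    also have "\<dots> \<le> ennreal (2 * ?K)"
      using divide_ennreal[of "2 * ?K" 2] by (simp add: ennreal_leI)
    finally show "?var ?L ?TU / 2 \<le> ennreal (2 * ?K)" .
    show "?var ?V ?SU / 2 \<le> signed_deficiency \<Theta> Y U V S"
      unfolding signed_deficiency_def kernel_dist_def set_kernel_def using \<theta> by (rule SUP_upper)
    show "?var ?SU ?TU / 2 \<le> kernel_dist \<Theta> Y (kernel_comp S U) (kernel_comp T U)"
      unfolding kernel_dist_def using \<theta> by (rule SUP_upper)
  qed
  finally show "tv_dist Y (rk_law_random_input Y P r N M y0 (U \<theta>)) (V \<theta>)
    \<le> ennreal (2 * ?K) + signed_deficiency \<Theta> Y U V S
      + kernel_dist \<Theta> Y (kernel_comp S U) (kernel_comp T U)"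
    unfolding tv_dist_def .
qed

lemma kernel_dist_normalization:
  assumes U: "U \<in> \<Theta> \<rightarrow>\<^sub>M prob_algebra X"
  shows "kernel_dist \<Theta> Y (kernel_comp S U) (kernel_comp T U)
    \<le> (SUP \<theta>\<in>space \<Theta>. \<integral>\<^sup>+x. ennreal (\<bar>p x - 1\<bar> + q x) \<partial>U \<theta>) / 2"
  unfolding kernel_dist_def
proof (rule SUP_least, rule divide_right_mono_ennreal)
  fix \<theta> assume \<theta>: "\<theta> \<in> space \<Theta>"
  have "variation Y (\<lambda>B. kernel_comp S U \<theta> B - kernel_comp T U \<theta> B) (space Y)
      \<le> (\<integral>\<^sup>+x. ennreal (\<bar>p x - 1\<bar> + q x) \<partial>U \<theta>)"
    using U \<theta> by (intro normalization_error measurable_space[where f=U])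
  also have "\<dots> \<le> (SUP \<theta>\<in>space \<Theta>. \<integral>\<^sup>+x. ennreal (\<bar>p x - 1\<bar> + q x) \<partial>U \<theta>)"
    using \<theta> by (rule SUP_upper)
  finally show "variation Y (\<lambda>B. kernel_comp S U \<theta> B - kernel_comp T U \<theta> B) (space Y)
      \<le> (SUP \<theta>\<in>space \<Theta>. \<integral>\<^sup>+x. ennreal (\<bar>p x - 1\<bar> + q x) \<partial>U \<theta>)" .
qed

end

text \<open>\<open>C\<close> is chosen before all spaces, kernels and costs, so the constant hidden
  in the running time depends on \<open>c\<close> alone; its value comes from
  \<open>rk_time_bound\<close>.\<close>

theorem lemma1:
  fixes c :: real
  assumes "0 \<le> c"
  shows "\<exists>C::real.
    \<forall>(\<Theta> :: 't measure) (X :: 'x measure) (Y :: 'y measure) U V S P r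
      (M :: real) (Tsamp :: real) (Teval :: real).
      standard_borel X \<and> standard_borel Y \<and>
      U \<in> \<Theta> \<rightarrow>\<^sub>M prob_algebra X \<and> V \<in> \<Theta> \<rightarrow>\<^sub>M prob_algebra Y \<and>
      signed_kernel X Y S \<and> 1 \<le> Teval \<and>
      M > 0 \<and> 1 \<le> Tsamp \<and> (\<forall>x\<in>space X. P x \<in> space (prob_algebra Y)) \<and>
      (\<forall>x\<in>space X. is_RN_deriv (P x) (pos_part Y (S x)) (r x)) \<and>
      (\<forall>x\<in>space X. \<forall>y\<in>space Y. r x y \<le> M) \<and>
      (\<forall>x\<in>space X. pos_mass Y (S x) > 0)
      \<longrightarrow>
      (\<forall>N\<ge>1. \<forall>y0\<in>space Y.
        (\<forall>x\<in>space X. \<forall>\<omega>\<in>space (rk_tape (P x)).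
           rk_time c Tsamp Teval (r x) N M y0 \<omega> \<le> C * (real N * (Teval + Tsamp))) \<and>
        (SUP \<theta>\<in>space \<Theta>. tv_dist Y (rk_law_random_input Y P r N M y0 (U \<theta>)) (V \<theta>))
          \<le> ennreal (2 * exp (- (real N / M * (INF x\<in>space X. pos_mass Y (S x)))))
            + signed_deficiency \<Theta> Y U V S
            + kernel_dist \<Theta> Y (kernel_comp S U) (kernel_comp (normalized_pos_kernel Y S) U) \<and>
        ennreal (2 * exp (- (real N / M * (INF x\<in>space X. pos_mass Y (S x)))))
            + signed_deficiency \<Theta> Y U V S
            + kernel_dist \<Theta> Y (kernel_comp S U) (kernel_comp (normalized_pos_kernel Y S) U)
          \<le> ennreal (2 * exp (- (real N / M * (INF x\<in>space X. pos_mass Y (S x)))))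
            + signed_deficiency \<Theta> Y U V S
            + (SUP \<theta>\<in>space \<Theta>.
                 \<integral>\<^sup>+x. ennreal (\<bar>pos_mass Y (S x) - 1\<bar> + neg_mass Y (S x)) \<partial>U \<theta>) / 2)"
  apply (rule exI[of _ "2 + 2 * c"])
  apply (intro allI impI)
  apply (elim conjE)
  apply (intro ballI conjI)
  subgoal using assms by (rule rk_time_bound)
  subgoal by (rule pos_signed_kernel.total_error) (unfold_locales, auto)
  subgoal by (intro add_left_mono pos_signed_kernel.kernel_dist_normalization) (unfold_locales, auto)
  done

end
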